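(* Let $G$ be a group acting by isometries on a real tree $T$, such that the action satisfies the stabilisation property. If the stabilisers of all points of $T\cup\partial T$ satisfy the power alternative, then so does $G$.
   Context: A group $G$ satisfies the power alternative if for every $g,h\in G$ there exists an integer $n\ge 1$ such that either $g^n$ and $h^n$ commute or $\langle g^n,h^n\rangle\cong F_2$. A metric space $T$ is a real tree if any two points $x,y\in T$ are joined by a unique geodesic segment $[x,y]$, and whenever $[x,y]\cap[y,z]=\{y\}$ one has $[x,y]\cup[y,z]=[x,z]$. $\partial T$ is its Gromov boundary. A geodesic in $T$ is an isometric embedding of an interval $I\subseteq\mathbb R$ into $T$ (segment, ray or line), identified with its image. Stabilisation property: an action of $G$ by isometries on a real tree $T$ has the stabilisation property if the following holds. Let $\{\gamma_n\}_{n\ge1}$ be any sequence of geodesics of $T$ that is monotonic for inclusion (either $\gamma_n\subset\gamma_{n+1}$ for all $n$, or $\gamma_{n+1}\subset\gamma_n$ for all $n$), let $\ell(\gamma_n)\in\mathbb R_{\ge0}\cup\{+\infty\}$ be the length of $\gamma_n$ and let $H_n\le G$ be the pointwise stabiliser of $\gamma_n$. If $\ell(\gamma_n)\to+\infty$, then there exists $N\ge1$ such that $H_n=H_{n+1}$ for all $n\ge N$. *)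

theory Defs
  imports "HOL-Analysis.Analysis" "HOL-Algebra.Group_Action" "HOL-Algebra.Generated_Groups"
begin

text \<open>A letter is a pair \<open>(x, b)\<close>, standing for the generator \<open>x\<close> if \<open>b\<close> and for its formal
  inverse otherwise.  The free group on \<open>X\<close> consists of the reduced words over \<open>X\<close>; the product
  of two reduced words is the reduced form of their concatenation, obtained by adding the letters
  of the first word one at a time on the left of the second.\<close>

definition inv_letter :: "'x \<times> bool \<Rightarrow> 'x \<times> bool" where
  "inv_letter a = (fst a, \<not> snd a)"

definition reduced_word :: "('x \<times> bool) list \<Rightarrow> bool" where
  "reduced_word w \<longleftrightarrow> (\<forall>i. Suc i < length w \<longrightarrow> w ! Suc i \<noteq> inv_letter (w ! i))"

fun reduced_cons :: "'x \<times> bool \<Rightarrow> ('x \<times> bool) list \<Rightarrow> ('x \<times> bool) list" where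
  "reduced_cons a [] = [a]"
| "reduced_cons a (b # w) = (if b = inv_letter a then w else a # b # w)"

definition free_group :: "'x set \<Rightarrow> ('x \<times> bool) list monoid" where
  "free_group X =
     \<lparr>carrier = {w. set w \<subseteq> X \<times> UNIV \<and> reduced_word w}, mult = foldr reduced_cons, one = []\<rparr>"

lemma inv_letter_inv_letter [simp]: "inv_letter (inv_letter a) = a"
  by (simp add: inv_letter_def)

lemma reduced_word_Nil [simp]: "reduced_word []"
  by (simp add: reduced_word_def)

lemma reduced_word_Cons:
  "reduced_word (a # w) \<longleftrightarrow> reduced_word w \<and> (w \<noteq> [] \<longrightarrow> hd w \<noteq> inv_letter a)"
  unfolding reduced_word_def
  by (cases w) (auto simp: nth_Cons less_Suc_eq_0_disj split: nat.splits)

lemma reduced_word_reduced_cons: "reduced_word w \<Longrightarrow> reduced_word (reduced_cons a w)"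
  by (cases w) (auto simp: reduced_word_Cons)

lemma reduced_word_foldr: "reduced_word w \<Longrightarrow> reduced_word (foldr reduced_cons u w)"
  by (induction u) (auto simp: reduced_word_reduced_cons)

lemma reduced_cons_inv:
  "reduced_word w \<Longrightarrow> reduced_cons a (reduced_cons (inv_letter a) w) = w"
  by (cases w rule: list.exhaust; cases "tl w") (auto simp: reduced_word_Cons)

lemma foldr_reduced_cons_Nil: "reduced_word w \<Longrightarrow> foldr reduced_cons w [] = w"
proof (induction w)
  case (Cons a w)
  then show ?case by (cases w) (auto simp: reduced_word_Cons)
qed simp

lemma foldr_reduced_cons_Cons:
  assumes "reduced_word w"
  shows "foldr reduced_cons (reduced_cons a u) w = reduced_cons a (foldr reduced_cons u w)"
proof (cases u)
  case (Cons b v)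
  then show ?thesis
    using reduced_cons_inv[OF reduced_word_foldr[OF assms], of a v] by auto
qed simp

lemma foldr_reduced_cons_assoc:
  assumes "reduced_word w"
  shows "foldr reduced_cons (foldr reduced_cons u v) w = foldr reduced_cons u (foldr reduced_cons v w)"
  by (induction u) (auto simp: foldr_reduced_cons_Cons[OF assms])

lemma set_reduced_cons: "set (reduced_cons a w) \<subseteq> insert a (set w)"
  by (cases w) auto

lemma set_foldr_reduced_cons: "set (foldr reduced_cons u w) \<subseteq> set u \<union> set w"
proof (induction u)
  case (Cons a u)
  then show ?case using set_reduced_cons[of a "foldr reduced_cons u w"] by auto
qed simp

lemma foldr_reduced_cons_inverse:
  "reduced_word w \<Longrightarrow> foldr reduced_cons (map inv_letter (rev u)) (foldr reduced_cons u w) = w"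
proof (induction u)
  case (Cons a u)
  then show ?case
    using reduced_cons_inv[OF reduced_word_foldr[OF Cons.prems], of "inv_letter a" u] by simp
qed simp

lemma group_free_group: "group (free_group X)"
proof (rule groupI)
  fix u v assume "u \<in> carrier (free_group X)" "v \<in> carrier (free_group X)"
  then show "u \<otimes>\<^bsub>free_group X\<^esub> v \<in> carrier (free_group X)"
    using set_foldr_reduced_cons[of u v] by (auto simp: free_group_def reduced_word_foldr)
next
  fix u assume u: "u \<in> carrier (free_group X)"
  let ?v = "foldr reduced_cons (map inv_letter (rev u)) []"
  have "set ?v \<subseteq> X \<times> UNIV"
    using u set_foldr_reduced_cons[of "map inv_letter (rev u)" "[]"]
    by (fastforce simp: free_group_def inv_letter_def)
  then have "?v \<in> carrier (free_group X)"
    by (simp add: free_group_def reduced_word_foldr)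
  moreover have "?v \<otimes>\<^bsub>free_group X\<^esub> u = \<one>\<^bsub>free_group X\<^esub>"
    using u foldr_reduced_cons_inverse[of "[]" u]
    by (simp add: free_group_def foldr_reduced_cons_assoc foldr_reduced_cons_Nil)
  ultimately show "\<exists>v\<in>carrier (free_group X). v \<otimes>\<^bsub>free_group X\<^esub> u = \<one>\<^bsub>free_group X\<^esub>"
    by blast
qed (auto simp: free_group_def foldr_reduced_cons_assoc)

abbreviation free_group_2 :: "(bool \<times> bool) list monoid" where
  "free_group_2 \<equiv> free_group (UNIV :: bool set)"

definition power_alternative :: "('g, 'm) monoid_scheme \<Rightarrow> bool" where
  "power_alternative G \<longleftrightarrow>
     (\<forall>g\<in>carrier G. \<forall>h\<in>carrier G. \<exists>n::nat. n \<ge> 1 \<and>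
        ((g [^]\<^bsub>G\<^esub> n) \<otimes>\<^bsub>G\<^esub> (h [^]\<^bsub>G\<^esub> n) = (h [^]\<^bsub>G\<^esub> n) \<otimes>\<^bsub>G\<^esub> (g [^]\<^bsub>G\<^esub> n) \<or>
         subgroup_generated G {g [^]\<^bsub>G\<^esub> n, h [^]\<^bsub>G\<^esub> n} \<cong> free_group_2))"

definition isometric_embedding_on :: "real set \<Rightarrow> (real \<Rightarrow> 'a::metric_space) \<Rightarrow> bool" where
  "isometric_embedding_on I c \<longleftrightarrow> (\<forall>s\<in>I. \<forall>t\<in>I. dist (c s) (c t) = dist s t)"

text \<open>The closed nonempty intervals are the possible domains of segments, rays and lines.\<close>

definition geodesic :: "real set \<Rightarrow> (real \<Rightarrow> 'a::metric_space) \<Rightarrow> bool" where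
  "geodesic I c \<longleftrightarrow> is_interval I \<and> closed I \<and> I \<noteq> {} \<and> isometric_embedding_on I c"

definition geodesic_segment_joining :: "'a::metric_space \<Rightarrow> 'a \<Rightarrow> 'a set \<Rightarrow> bool" where
  "geodesic_segment_joining x y S \<longleftrightarrow>
     (\<exists>a b c. a \<le> b \<and> geodesic {a..b} c \<and> c a = x \<and> c b = y \<and> S = c ` {a..b})"

definition geodesic_segment :: "'a::metric_space \<Rightarrow> 'a \<Rightarrow> 'a set" where
  "geodesic_segment x y = (THE S. geodesic_segment_joining x y S)"

class real_tree = metric_space +
  assumes unique_geodesic_segment: "\<exists>!S. geodesic_segment_joining x y S"
    and geodesic_segment_concat:
      "geodesic_segment x y \<inter> geodesic_segment y z = {y} \<Longrightarrow>
       geodesic_segment x y \<union> geodesic_segment y z = geodesic_segment x z"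

definition gromov_product :: "'a::metric_space \<Rightarrow> 'a \<Rightarrow> 'a \<Rightarrow> real" where
  "gromov_product p x y = (dist p x + dist p y - dist x y) / 2"

text \<open>Changing the base point \<open>p\<close> to \<open>q\<close> changes the Gromov product by at most \<open>dist p q\<close>, so
  quantifying over all base points below is the same as fixing one.\<close>

definition gromov_equivalent :: "(nat \<Rightarrow> 'a::metric_space) \<Rightarrow> (nat \<Rightarrow> 'a) \<Rightarrow> bool" where
  "gromov_equivalent s t \<longleftrightarrow>
     (\<forall>p. filterlim (\<lambda>(i, j). gromov_product p (s i) (t j)) at_top (sequentially \<times>\<^sub>F sequentially))"

definition converges_at_infinity :: "(nat \<Rightarrow> 'a::metric_space) \<Rightarrow> bool" where
  "converges_at_infinity s \<longleftrightarrow> gromov_equivalent s s"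

definition gromov_boundary :: "(nat \<Rightarrow> 'a::metric_space) set set" where
  "gromov_boundary =
     {s. converges_at_infinity s} //
     {(s, t). converges_at_infinity s \<and> converges_at_infinity t \<and> gromov_equivalent s t}"

definition isometric_action :: "('g, 'm) monoid_scheme \<Rightarrow> ('g \<Rightarrow> 'a::metric_space \<Rightarrow> 'a) \<Rightarrow> bool" where
  "isometric_action G \<phi> \<longleftrightarrow>
     group_action G UNIV \<phi> \<and> (\<forall>g\<in>carrier G. \<forall>x y. dist (\<phi> g x) (\<phi> g y) = dist x y)"

definition boundary_action :: "('g \<Rightarrow> 'a::metric_space \<Rightarrow> 'a) \<Rightarrow> 'g \<Rightarrow> (nat \<Rightarrow> 'a) set \<Rightarrow> (nat \<Rightarrow> 'a) set" where
  "boundary_action \<phi> g \<xi> = (\<lambda>s. \<phi> g \<circ> s) ` \<xi>"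

definition pointwise_stabilizer :: "('g, 'm) monoid_scheme \<Rightarrow> ('g \<Rightarrow> 'a \<Rightarrow> 'a) \<Rightarrow> 'a set \<Rightarrow> 'g set" where
  "pointwise_stabilizer G \<phi> S = {g \<in> carrier G. \<forall>x\<in>S. \<phi> g x = x}"

text \<open>The \<open>n\<close>-th geodesic is the image of \<open>c n\<close> on the interval \<open>I n\<close>; its length is the
  Lebesgue measure of \<open>I n\<close>.\<close>

definition stabilisation_property :: "('g, 'm) monoid_scheme \<Rightarrow> ('g \<Rightarrow> 'a::metric_space \<Rightarrow> 'a) \<Rightarrow> bool" where
  "stabilisation_property G \<phi> \<longleftrightarrow>
     (\<forall>(I :: nat \<Rightarrow> real set) (c :: nat \<Rightarrow> real \<Rightarrow> 'a).
        (\<forall>n. geodesic (I n) (c n)) \<longrightarrow>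
        ((\<forall>n. c n ` I n \<subseteq> c (Suc n) ` I (Suc n)) \<or> (\<forall>n. c (Suc n) ` I (Suc n) \<subseteq> c n ` I n)) \<longrightarrow>
        (\<lambda>n. emeasure lborel (I n)) \<longlonglongrightarrow> \<infinity> \<longrightarrow>
        (\<exists>N. \<forall>n\<ge>N. pointwise_stabilizer G \<phi> (c n ` I n) =
                     pointwise_stabilizer G \<phi> (c (Suc n) ` I (Suc n))))"

end

theory Submission
  imports Defs
begin

text \<open>
  An isometry of a real tree either fixes a point or translates along an axis. So let \<open>g\<close> and \<open>h\<close> be
  given and suppose that no common power puts them in the stabiliser of a point or of an end; we show
  that some powers play ping-pong on a set \<open>A\<close> and its complement, hence generate a free group.

  If \<open>g\<close> fixes \<open>p\<close> and \<open>h\<close> fixes \<open>q\<close>, the points of \<open>[p, q]\<close> fixed by a nontrivial power of \<open>g\<close> form an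
  initial piece, disjoint from the terminal piece fixed by powers of \<open>h\<close>; let \<open>A\<close> be the set of points
  projecting to the initial piece. If \<open>g\<close> has an axis, let \<open>A\<close> be the set of points projecting to a long
  bounded piece of it, which large powers of \<open>g\<close> push off itself. If \<open>h\<close> has an axis as well, the two
  axes share no ray, so large powers of \<open>h\<close> map the complement of \<open>A\<close> into \<open>A\<close>. If \<open>h\<close> fixes a point,
  the stabilisation property shows that the points of the axis of \<open>g\<close> fixed by nontrivial powers of
  \<open>h\<close> form a bounded set, for otherwise one power of \<open>h\<close> would fix a whole ray; outside of this set, a
  nontrivial power of \<open>h\<close> can only match the two halves of the axis by swapping them, and all but at
  most one exponent (up to sign) is excluded.
\<close>

section \<open>Geodesics in real trees\<close>

lemma geodesic_segment_joining_geodesic_segment: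
  fixes x y :: "'a::real_tree"
  shows "geodesic_segment_joining x y (geodesic_segment x y)"
  unfolding geodesic_segment_def by (rule theI') (rule unique_geodesic_segment)

lemma geodesic_segment_eqI:
  fixes x y :: "'a::real_tree"
  shows "geodesic_segment_joining x y S \<Longrightarrow> geodesic_segment x y = S"
  using unique_geodesic_segment[of x y] geodesic_segment_joining_geodesic_segment by blast

lemma geodesic_segment_parametrization:
  fixes x y :: "'a::real_tree"
  obtains c where "c 0 = x" "c (dist x y) = y" "geodesic_segment x y = c ` {0..dist x y}"
    "\<And>s t. s \<in> {0..dist x y} \<Longrightarrow> t \<in> {0..dist x y} \<Longrightarrow> dist (c s) (c t) = \<bar>s - t\<bar>"
proof -
  obtain a b c where ab: "a \<le> b" and c: "geodesic {a..b} c" "c a = x" "c b = y"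
    and S: "geodesic_segment x y = c ` {a..b}"
    using geodesic_segment_joining_geodesic_segment[of x y]
    unfolding geodesic_segment_joining_def by blast
  have iso: "dist (c s) (c t) = \<bar>s - t\<bar>" if "s \<in> {a..b}" "t \<in> {a..b}" for s t
    using c(1) that by (simp add: geodesic_def isometric_embedding_on_def dist_real_def)
  have d: "dist x y = b - a"
    using iso[of a b] ab c by simp
  have "(\<lambda>t. t + a) ` {0..dist x y} = {a..b}"
    by (simp add: d)
  then have "geodesic_segment x y = (\<lambda>t. c (t + a)) ` {0..dist x y}"
    using S by (metis image_image)
  moreover have "dist (c (s + a)) (c (t + a)) = \<bar>s - t\<bar>"
    if "s \<in> {0..dist x y}" "t \<in> {0..dist x y}" for s t
    using that iso[of "s + a" "t + a"] d by simp
  ultimately show ?thesis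
    using that[of "\<lambda>t. c (t + a)"] c d by simp
qed

text \<open>This lets distance equations replace segments below. For the converse, geodesics from
  \<open>x\<close> to \<open>z\<close> and from \<open>z\<close> to \<open>y\<close> are glued; the
  result is again a geodesic, so it is the unique one.\<close>

lemma mem_geodesic_segment_iff:
  fixes x y z :: "'a::real_tree"
  shows "z \<in> geodesic_segment x y \<longleftrightarrow> dist x z + dist z y = dist x y"
proof
  obtain c where c: "c 0 = x" "c (dist x y) = y" "geodesic_segment x y = c ` {0..dist x y}"
    "\<And>s t. s \<in> {0..dist x y} \<Longrightarrow> t \<in> {0..dist x y} \<Longrightarrow> dist (c s) (c t) = \<bar>s - t\<bar>"
    using geodesic_segment_parametrization[of x y] by metis
  assume "z \<in> geodesic_segment x y"
  then obtain t where t: "t \<in> {0..dist x y}" "z = c t"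
    using c(3) by auto
  show "dist x z + dist z y = dist x y"
    using c(4)[of 0 t] c(4)[of t "dist x y"] t c(1,2) by simp
next
  assume *: "dist x z + dist z y = dist x y"
  obtain c where c: "c 0 = x" "c (dist x z) = z"
    "\<And>s t. s \<in> {0..dist x z} \<Longrightarrow> t \<in> {0..dist x z} \<Longrightarrow> dist (c s) (c t) = \<bar>s - t\<bar>"
    using geodesic_segment_parametrization[of x z] by metis
  obtain e where e: "e 0 = z" "e (dist z y) = y"
    "\<And>s t. s \<in> {0..dist z y} \<Longrightarrow> t \<in> {0..dist z y} \<Longrightarrow> dist (e s) (e t) = \<bar>s - t\<bar>"
    using geodesic_segment_parametrization[of z y] by metis
  define f where "f t = (if t \<le> dist x z then c t else e (t - dist x z))" for t
  have f0: "f 0 = x" by (simp add: f_def c)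
  have fz: "f (dist x z) = z" by (simp add: f_def c)
  have fy: "f (dist x y) = y" 
  proof (cases "dist z y = 0")
    case True then show ?thesis using * fz by simp
  next
    case False
    then have "dist z y > 0" using zero_le_dist[of z y] by linarith
    then show ?thesis using * e by (simp add: f_def flip: *)
  qed
  have le: "dist (f s) (f t) = t - s" if "0 \<le> s" "s \<le> t" "t \<le> dist x y" for s t
  proof -
    consider "t \<le> dist x z" | "s > dist x z" | "s \<le> dist x z" "t > dist x z" by linarith
    then show ?thesis
    proof cases
      case 1 then show ?thesis using that c(3)[of s t] by (simp add: f_def)
    next
      case 2 then show ?thesis using that * e(3)[of "s - dist x z" "t - dist x z"] by (simp add: f_def)
    next
      case 3
      let ?u = "c s" and ?v = "e (t - dist x z)"
      have "dist x ?u = s" "dist ?u z = dist x z - s"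
        using c(3)[of 0 s] c(3)[of s "dist x z"] c(1,2) that 3 by simp_all
      moreover have "dist z ?v = t - dist x z" "dist ?v y = dist x y - t"
        using e(3)[of 0 "t - dist x z"] e(3)[of "t - dist x z" "dist z y"] e(1,2) that 3 * by simp_all
      moreover have "dist x y \<le> dist x ?u + dist ?u ?v + dist ?v y"
        using dist_triangle[of x y ?v] dist_triangle[of x ?v ?u] by linarith
      moreover have "dist ?u ?v \<le> dist ?u z + dist z ?v"
        by (rule dist_triangle)
      ultimately show ?thesis using 3 by (simp add: f_def)
    qed
  qed
  have "geodesic {0..dist x y} f"
    unfolding geodesic_def isometric_embedding_on_def
  proof (intro conjI ballI)
    fix s t assume "s \<in> {0..dist x y}" "t \<in> {0..dist x y}"
    then show "dist (f s) (f t) = dist s t"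
      using le[of s t] le[of t s] by (cases "s \<le> t") (auto simp: dist_real_def dist_commute)
  qed auto
  then have "geodesic_segment_joining x y (f ` {0..dist x y})"
    unfolding geodesic_segment_joining_def using f0 fy zero_le_dist by blast
  then have "geodesic_segment x y = f ` {0..dist x y}"
    by (rule geodesic_segment_eqI)
  then show "z \<in> geodesic_segment x y"
    using fz * zero_le_dist[of x z] zero_le_dist[of z y] by (metis atLeastAtMost_iff image_eqI le_add_same_cancel1)
qed

lemma point_between_exists:
  fixes x y :: "'a::real_tree"
  assumes "0 \<le> t" "t \<le> dist x y"
  obtains z where "dist x z = t" "dist z y = dist x y - t"
proof -
  obtain c where c: "c 0 = x" "c (dist x y) = y"
    "\<And>s t. s \<in> {0..dist x y} \<Longrightarrow> t \<in> {0..dist x y} \<Longrightarrow> dist (c s) (c t) = \<bar>s - t\<bar>"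
    using geodesic_segment_parametrization[of x y] by metis
  show thesis
    using c(3)[of 0 t] c(3)[of t "dist x y"] c(1,2) assms by (intro that[of "c t"]) simp_all
qed

text \<open>Both points are read off in one arc length parametrisation. The usual application has
  equal distances from \<open>x\<close> and concludes \<open>u = v\<close>.\<close>

lemma dist_points_between:
  fixes x y u v :: "'a::real_tree"
  assumes "dist x u + dist u y = dist x y" "dist x v + dist v y = dist x y"
  shows "dist u v = \<bar>dist x u - dist x v\<bar>"
proof -
  obtain c where c: "c 0 = x" "c (dist x y) = y" "geodesic_segment x y = c ` {0..dist x y}"
    "\<And>s t. s \<in> {0..dist x y} \<Longrightarrow> t \<in> {0..dist x y} \<Longrightarrow> dist (c s) (c t) = \<bar>s - t\<bar>"
    using geodesic_segment_parametrization[of x y] by metis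
  obtain s t where st: "s \<in> {0..dist x y}" "u = c s" "t \<in> {0..dist x y}" "v = c t"
    using assms c(3) by (auto simp flip: mem_geodesic_segment_iff)
  show ?thesis
    using c(4)[of s t] c(4)[of 0 s] c(4)[of 0 t] c(1) st by simp
qed

text \<open>The median is the last point at which the geodesics from \<open>x\<close> to \<open>y\<close> and from \<open>x\<close> to \<open>z\<close> agree;
  beyond it they only meet in that point, so the concatenation axiom applies.\<close>

lemma median_exists:
  fixes x y z :: "'a::real_tree"
  obtains m where "dist x m + dist m y = dist x y" "dist x m + dist m z = dist x z"
    "dist y m + dist m z = dist y z"
proof -
  obtain c where c: "c 0 = x" "c (dist x y) = y" "geodesic_segment x y = c ` {0..dist x y}"
    "\<And>s t. s \<in> {0..dist x y} \<Longrightarrow> t \<in> {0..dist x y} \<Longrightarrow> dist (c s) (c t) = \<bar>s - t\<bar>"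
    using geodesic_segment_parametrization[of x y] by metis
  obtain e where e: "e 0 = x" "e (dist x z) = z" "geodesic_segment x z = e ` {0..dist x z}"
    "\<And>s t. s \<in> {0..dist x z} \<Longrightarrow> t \<in> {0..dist x z} \<Longrightarrow> dist (e s) (e t) = \<bar>s - t\<bar>"
    using geodesic_segment_parametrization[of x z] by metis
  define L where "L = min (dist x y) (dist x z)"
  define S where "S = {t \<in> {0..L}. dist (c t) (e t) = 0}"
  have "1-lipschitz_on {0..L} c" "1-lipschitz_on {0..L} e"
    by (auto intro!: lipschitz_onI simp: c(4) e(4) L_def dist_real_def)
  then have "continuous_on {0..L} c" "continuous_on {0..L} e"
    by (auto intro: lipschitz_on_continuous_on)
  then have "continuous_on {0..L} (\<lambda>t. dist (c t) (e t))"
    by (intro continuous_intros)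
  then have "closed S"
    unfolding S_def by (rule continuous_closed_preimage_constant) simp
  then have "compact ({0..L} \<inter> S)"
    by (intro compact_Int_closed) auto
  moreover have "{0..L} \<inter> S = S"
    by (auto simp: S_def)
  moreover have "0 \<in> S"
    by (simp add: S_def L_def c e)
  ultimately obtain r where r: "r \<in> S" "\<And>t. t \<in> S \<Longrightarrow> t \<le> r"
    using compact_attains_sup[of S] by (metis empty_iff)
  define m where "m = c r"
  have rL: "0 \<le> r" "r \<le> dist x y" "r \<le> dist x z" and me: "m = e r"
    using r(1) by (auto simp: S_def L_def m_def)
  have my: "dist x m = r" "dist m y = dist x y - r"
    using c(4)[of 0 r] c(4)[of r "dist x y"] c(1,2) rL by (simp_all add: m_def)
  have mz: "dist m z = dist x z - r"
    using e(4)[of r "dist x z"] e(2) rL by (simp add: me)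
  have "geodesic_segment y m \<inter> geodesic_segment m z = {m}"
  proof (intro equalityI subsetI)
    fix w assume "w \<in> geodesic_segment y m \<inter> geodesic_segment m z"
    then have w: "dist y w + dist w m = dist y m" "dist m w + dist w z = dist m z"
      by (simp_all add: mem_geodesic_segment_iff)
    \<comment> \<open>\<open>w\<close> lies on both geodesics from \<open>x\<close>, so its distance
      from \<open>x\<close> belongs to \<open>S\<close>; as it lies past \<open>m\<close>,
      maximality of \<open>r\<close> leaves only \<open>w = m\<close>.\<close>
    have wy: "dist x w + dist w y = dist x y"
      using w my dist_triangle[of x y w] dist_triangle[of x w m] by (simp add: dist_commute)
    have wz: "dist x w + dist w z = dist x z"
      using w my mz dist_triangle[of x z w] dist_triangle[of x w m] by (simp add: dist_commute)
    have s: "dist x w = r + dist m w"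
      using w my wy by (simp add: dist_commute)
    obtain s t where st: "s \<in> {0..dist x y}" "w = c s" "t \<in> {0..dist x z}" "w = e t"
      using wy wz c(3) e(3) by (metis imageE mem_geodesic_segment_iff)
    have "s = dist x w" "t = dist x w"
      using c(4)[of 0 s] e(4)[of 0 t] c(1) e(1) st by simp_all
    then have "dist x w \<in> S"
      using st by (simp add: S_def L_def)
    then have "dist m w \<le> 0"
      using r(2)[of "dist x w"] s by simp
    then show "w \<in> {m}" by simp
  qed (simp add: mem_geodesic_segment_iff)
  from geodesic_segment_concat[OF this] have "m \<in> geodesic_segment y z"
    by (metis UnI1 dist_self add.right_neutral mem_geodesic_segment_iff)
  then show thesis
    using my mz by (intro that[of m]) (simp_all add: mem_geodesic_segment_iff)
qed

text \<open>Zero-hyperbolicity. The two products on the left are the distances from \<open>p\<close>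
  to two medians, both on the segment from \<open>p\<close> to \<open>y\<close>; the route from
  \<open>x\<close> to \<open>z\<close> through these medians gives the bound.\<close>

lemma gromov_product_hyperbolic:
  fixes p x y z :: "'a::real_tree"
  shows "min (gromov_product p x y) (gromov_product p y z) \<le> gromov_product p x z"
proof -
  have *: "gromov_product p x y \<le> gromov_product p x z"
    if "gromov_product p x y \<le> gromov_product p y z" for x y z :: 'a
  proof -
    obtain m where m: "dist p m + dist m x = dist p x" "dist p m + dist m y = dist p y"
      "dist x m + dist m y = dist x y" using median_exists .
    obtain n where n: "dist p n + dist n y = dist p y" "dist p n + dist n z = dist p z"
      "dist y n + dist n z = dist y z" using median_exists .
    have pm: "dist p m = gromov_product p x y" and pn: "dist p n = gromov_product p y z"
      using m n by (simp_all add: gromov_product_def dist_commute)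
    have "dist m n = dist p n - dist p m"
      using dist_points_between[OF m(2) n(1)] pm pn that by simp
    then have "dist x z \<le> dist x p + dist p z - 2 * dist p m"
      using m n dist_triangle[of x z m] dist_triangle[of m z n] by (simp add: dist_commute)
    then show ?thesis
      unfolding pm[symmetric] by (simp add: gromov_product_def dist_commute)
  qed
  show ?thesis
    using *[of x y z] *[of z y x]
    by (cases "gromov_product p x y \<le> gromov_product p y z")
      (auto simp: gromov_product_def dist_commute add.commute)
qed

text \<open>Hyperbolicity at the base point \<open>w\<close>, multiplied out.\<close>

lemma four_point:
  fixes x y z w :: "'a::real_tree"
  shows "dist x y + dist z w \<le> max (dist x z + dist y w) (dist x w + dist y z)"
  using gromov_product_hyperbolic[of w x z y]
  by (simp add: gromov_product_def dist_commute min_def max_def split: if_splits)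

text \<open>Hyperbolicity along the chain \<open>u\<close>, \<open>x\<close>, \<open>y\<close>,
  \<open>v\<close> bounds \<open>gromov_product p u v\<close> below by \<open>dist p u\<close>,
  which leaves no room for a positive \<open>dist u v\<close>.\<close>

lemma geodesics_agree:
  fixes p x y u v :: "'a::real_tree"
  assumes "dist p u + dist u x = dist p x" "dist p v + dist v y = dist p y"
    and "dist p u = dist p v" "dist p u \<le> gromov_product p x y"
  shows "u = v"
proof -
  have "gromov_product p u x = dist p u" "gromov_product p y v = dist p u"
    using assms by (simp_all add: gromov_product_def dist_commute)
  then have "dist p u \<le> gromov_product p u v"
    using gromov_product_hyperbolic[of p u x y] gromov_product_hyperbolic[of p u y v] assms(4)
    by linarith
  then show ?thesis
    using assms(3) by (simp add: gromov_product_def)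
qed

text \<open>The point on the way from \<open>p\<close> to \<open>z\<close> at distance
  \<open>dist p u\<close> equals \<open>u\<close>, and its image, on the way to \<open>f z\<close>
  at the same distance, equals \<open>u\<close> as well.\<close>

lemma isometry_fixes_common_part:
  fixes f :: "'a::real_tree \<Rightarrow> 'a"
  assumes iso: "\<And>x y. dist (f x) (f y) = dist x y" and p: "f p = p"
    and u: "dist p u + dist u q = dist p q" "dist p u \<le> gromov_product p z q"
      "dist p u \<le> gromov_product p (f z) q"
  shows "f u = u"
proof -
  have "dist p u \<le> dist p z"
    using u(2) dist_triangle[of p q z] by (simp add: gromov_product_def)
  then obtain v where v: "dist p v = dist p u" "dist v z = dist p z - dist p u"
    using point_between_exists[of "dist p u" p z] zero_le_dist by metis
  have "v = u"
    using v u by (intro geodesics_agree[of p v z u q]) simp_all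
  moreover have "f v = u"
    using v u iso[of p v] iso[of v z] iso[of p z] p
    by (intro geodesics_agree[of p "f v" "f z" u q]) simp_all
  ultimately show ?thesis by simp
qed

section \<open>Lines and axes\<close>

lemma line_projection_exists:
  fixes l :: "real \<Rightarrow> 'a::real_tree"
  assumes "isometric_embedding_on UNIV l"
  obtains s where "\<And>t. dist z (l t) = dist z (l s) + \<bar>t - s\<bar>"
proof -
  have iso: "dist (l s) (l t) = \<bar>s - t\<bar>" for s t
    using assms by (simp add: isometric_embedding_on_def dist_real_def)
  \<comment> \<open>The summand 1 makes \<open>R\<close> strictly larger than
    \<open>dist z (l 0)\<close>, which bounds the absolute value of \<open>s\<close>.\<close>
  define R where "R = dist z (l 0) + 1"
  have R: "R > 0" by (simp add: R_def add_nonneg_pos)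
  \<comment> \<open>If the formula holds with distance \<open>D\<close> to the line, its values at
    \<open>R\<close> and \<open>- R\<close> are \<open>D + R - s\<close> and
    \<open>D + R + s\<close>; solving for \<open>s\<close> and \<open>D\<close> gives these
    definitions.\<close>
  define s where "s = (dist z (l (- R)) - dist z (l R)) / 2"
  define D where "D = (dist z (l (- R)) + dist z (l R)) / 2 - R"
  have "dist z (l R) \<le> dist z (l 0) + R" "dist z (l R) \<ge> R - dist z (l 0)"
    "dist z (l (-R)) \<le> dist z (l 0) + R" "dist z (l (-R)) \<ge> R - dist z (l 0)"
    using dist_triangle[of z "l R" "l 0"] dist_triangle[of "l 0" "l R" z]
      dist_triangle[of z "l (-R)" "l 0"] dist_triangle[of "l 0" "l (-R)" z] iso R
    by (simp_all add: dist_commute)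
  then have sR: "\<bar>s\<bar> < R"
    by (auto simp: s_def R_def abs_if field_simps)
  have near: "dist z (l t) = D + \<bar>t - s\<bar>" if "\<bar>t\<bar> \<le> R" for t
  proof -
    have "dist z (l t) + 2 * R \<le> max (dist z (l R) + (t + R)) (dist z (l (-R)) + (R - t))"
      using four_point[of z "l t" "l R" "l (-R)"] that R by (auto simp: iso abs_if split: if_splits)
    moreover have "dist z (l R) \<le> dist z (l t) + (R - t)" "dist z (l (-R)) \<le> dist z (l t) + (R + t)"
      using dist_triangle[of z "l R" "l t"] dist_triangle[of z "l (-R)" "l t"] that by (simp_all add: iso)
    ultimately show ?thesis
      by (auto simp: D_def s_def abs_if max_def field_simps split: if_splits)
  qed
  have D: "dist z (l s) = D" using near[of s] sR by simp
  have far: "dist z (l t) = D + \<bar>t - s\<bar>" if "\<bar>t\<bar> > R" for t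
  proof -
    define r where "r = (if t > 0 then R else - R)"
    have "\<bar>r\<bar> \<le> R" using R by (simp add: r_def)
    then have "dist z (l r) = D + \<bar>r - s\<bar>" by (rule near)
    moreover have "dist z (l r) + \<bar>s - t\<bar> \<le> max (D + \<bar>r - t\<bar>) (dist z (l t) + \<bar>r - s\<bar>)"
      using four_point[of z "l r" "l s" "l t"] D by (simp add: iso)
    moreover have "dist z (l t) \<le> D + \<bar>s - t\<bar>"
      using dist_triangle[of z "l t" "l s"] D by (simp add: iso)
    ultimately show ?thesis
      using sR that R by (auto simp: r_def abs_if max_def split: if_splits)
  qed
  show thesis
    using near far D by (intro that[of s]) (metis not_le)
qed

text \<open>The coordinate of the point of \<open>l\<close> nearest to \<open>z\<close>; for a line
  in a real tree such a coordinate exists and is unique.\<close>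

definition line_projection :: "(real \<Rightarrow> 'a::metric_space) \<Rightarrow> 'a \<Rightarrow> real" where
  "line_projection l z = (SOME s. \<forall>t. dist z (l t) = dist z (l s) + \<bar>t - s\<bar>)"

lemma dist_line:
  fixes l :: "real \<Rightarrow> 'a::real_tree"
  assumes "isometric_embedding_on UNIV l"
  shows "dist z (l t) = dist z (l (line_projection l z)) + \<bar>t - line_projection l z\<bar>"
proof -
  have "\<exists>s. \<forall>t. dist z (l t) = dist z (l s) + \<bar>t - s\<bar>"
    using line_projection_exists[OF assms] by metis
  from someI_ex[OF this] show ?thesis
    unfolding line_projection_def by blast
qed

lemma line_projection_eqI:
  fixes l :: "real \<Rightarrow> 'a::real_tree"
  assumes "isometric_embedding_on UNIV l" "\<And>t. dist z (l t) = D + \<bar>t - s\<bar>"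
  shows "line_projection l z = s"
  using dist_line[OF assms(1), of z s] assms(2)[of s] assms(2)[of "line_projection l z"] by simp

text \<open>The points of the line nearest to \<open>p\<close> and \<open>z\<close> are
  \<open>l 0\<close> and \<open>l s\<close>. As \<open>s \<noteq> 0\<close>, the four-point
  condition forces the geodesic from \<open>p\<close> to \<open>z\<close> to follow the line from
  one to the other.\<close>

lemma line_point_between:
  fixes l :: "real \<Rightarrow> 'a::real_tree"
  assumes l: "isometric_embedding_on UNIV l" and p: "\<And>t. dist p (l t) = D + \<bar>t\<bar>"
    and s: "s = line_projection l z" and t: "\<bar>t\<bar> < \<bar>s\<bar>" "0 \<le> s * t"
  shows "dist p (l t) + dist (l t) z = dist p z"
proof -
  have iso: "dist (l s) (l t) = \<bar>s - t\<bar>" for s t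
    using l by (simp add: isometric_embedding_on_def dist_real_def)
  define E where "E = dist z (l s)"
  have z: "dist z (l t) = E + \<bar>t - s\<bar>" for t
    using dist_line[OF l, of z t] by (simp add: s E_def)
  have "dist p (l s) + dist z (l 0) \<le> max (dist p z + \<bar>s\<bar>) (D + E)"
    using four_point[of p "l s" z "l 0"] p[of 0] z[of s] iso[of s 0] by (simp add: dist_commute)
  then have "dist p z \<ge> D + E + \<bar>s\<bar>"
    using t p[of s] z[of 0] by (auto simp: max_def split: if_splits)
  moreover have "\<bar>t\<bar> + \<bar>t - s\<bar> = \<bar>s\<bar>"
    using t by (auto simp: abs_if zero_le_mult_iff split: if_splits)
  ultimately show ?thesis
    using p[of t] z[of t] dist_triangle[of p z "l t"] by (simp add: dist_commute)
qed


text \<open>The geodesic from \<open>p\<close> to \<open>l (\<epsilon> * R)\<close> is carried to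
  the one to \<open>l (\<delta> * R)\<close>, preserving distances from \<open>p\<close>. The signs
  select halves of the line, so fixing a half and swapping the halves are both covered.\<close>

lemma isometry_between_rays:
  fixes f :: "'a::real_tree \<Rightarrow> 'a"
  assumes iso: "\<And>x y. dist (f x) (f y) = dist x y" and p: "f p = p"
    and l: "isometric_embedding_on UNIV l" and D: "\<And>t. dist p (l t) = D + \<bar>t\<bar>"
    and sign: "\<bar>\<epsilon>\<bar> = 1" "\<bar>\<delta>\<bar> = 1" and R: "f (l (\<epsilon> * R)) = l (\<delta> * R)" and t: "0 \<le> t" "t \<le> R"
  shows "f (l (\<epsilon> * t)) = l (\<delta> * t)"
proof -
  have l_dist: "dist (l (\<sigma> * s)) (l (\<sigma> * t)) = \<bar>s - t\<bar>" if "\<bar>\<sigma>\<bar> = 1" for \<sigma> s t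
    using l that by (simp add: isometric_embedding_on_def dist_real_def abs_mult flip: right_diff_distrib)
  have D': "dist p (l (\<sigma> * s)) = D + \<bar>s\<bar>" if "\<bar>\<sigma>\<bar> = 1" for \<sigma> s
    using D that by (simp add: abs_mult)
  have "dist p (f (l (\<epsilon> * t))) = D + t" "dist (f (l (\<epsilon> * t))) (l (\<delta> * R)) = R - t"
    using iso[of p "l (\<epsilon> * t)"] iso[of "l (\<epsilon> * t)" "l (\<epsilon> * R)"] p R l_dist[OF sign(1), of t R] 
      D'[OF sign(1), of t] t by simp_all
  moreover have "dist p (l (\<delta> * t)) = D + t" "dist (l (\<delta> * t)) (l (\<delta> * R)) = R - t"
    "dist p (l (\<delta> * R)) = D + R"
    using l_dist[OF sign(2), of t R] D'[OF sign(2)] t by simp_all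
  ultimately show ?thesis
    using dist_points_between[of p "f (l (\<epsilon> * t))" "l (\<delta> * R)" "l (\<delta> * t)"] by simp
qed

text \<open>The sign tells which half of the line the geodesic from \<open>p\<close> to
  \<open>z\<close> follows. \<open>S\<close> is separate from \<open>R\<close> because with two axes
  the projection bound is \<open>R\<close> while the point sought has coordinate
  \<open>R - D\<close>.\<close>

lemma geodesic_meets_ray:
  fixes l :: "real \<Rightarrow> 'a::real_tree"
  assumes l: "isometric_embedding_on UNIV l" and D: "\<And>t. dist p (l t) = D + \<bar>t\<bar>"
    and R: "\<bar>R\<bar> \<le> S" "S < \<bar>line_projection l z\<bar>" "0 \<le> R"
  obtains \<epsilon> where "\<bar>\<epsilon>\<bar> = 1" "dist p (l (\<epsilon> * R)) = D + R" "dist (l (\<epsilon> * R)) z = dist p z - (D + R)"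
proof -
  define \<epsilon> :: real where "\<epsilon> = (if line_projection l z \<ge> 0 then 1 else - 1)"
  have "\<bar>\<epsilon>\<bar> = 1" by (simp add: \<epsilon>_def)
  moreover have "dist p (l (\<epsilon> * R)) = D + R"
    using D[of "\<epsilon> * R"] \<open>\<bar>\<epsilon>\<bar> = 1\<close> R by (simp add: abs_mult)
  moreover have "dist p (l (\<epsilon> * R)) + dist (l (\<epsilon> * R)) z = dist p z"
    using R by (intro line_point_between[OF l D refl]) (auto simp: \<epsilon>_def mult_nonpos_nonneg)
  ultimately show thesis using that[of \<epsilon>] by simp
qed

text \<open>Let \<open>e\<close> be the length shared by the segments from \<open>f x\<close> to
  \<open>x\<close> and to \<open>f (f x)\<close>. If it reaches half of \<open>dist x (f x)\<close>,
  the midpoint is fixed; otherwise trimming \<open>e\<close> at both ends leaves a segment from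
  \<open>p\<close> to \<open>f p\<close> that continues to \<open>f (f p)\<close> without
  backtracking.\<close>

lemma fixed_point_or_aligned_orbit:
  fixes f :: "'a::real_tree \<Rightarrow> 'a"
  assumes iso: "\<And>x y. dist (f x) (f y) = dist x y"
  obtains p where "f p = p" | p where "f p \<noteq> p" "dist p (f (f p)) = 2 * dist p (f p)"
proof (cases "\<exists>p. f p = p")
  case True
  then show thesis using that(1) by blast
next
  case False
  fix x :: 'a
  define d where "d = dist x (f x)"
  define e where "e = gromov_product (f x) x (f (f x))"
  have ff: "dist (f x) (f (f x)) = d" by (simp add: d_def iso)
  have d: "d > 0" using False by (simp add: d_def) metis
  have e0: "e \<ge> 0"
    using dist_triangle[of x "f (f x)" "f x"] by (simp add: e_def gromov_product_def dist_commute)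
  have e: "e < d / 2"
  proof (rule ccontr)
    assume "\<not> e < d / 2"
    obtain m where m: "dist x m = d / 2" "dist m (f x) = d - d / 2"
      using point_between_exists[of "d / 2" x "f x"] d by (auto simp: d_def)
    \<comment> \<open>\<open>f m\<close> is the midpoint of \<open>f x\<close> and
      \<open>f (f x)\<close>; both midpoints lie at distance \<open>d / 2\<close> from
      \<open>f x\<close>, within the common part.\<close>
    have "m = f m"
      using m ff iso[of x m] iso[of m "f x"] \<open>\<not> e < d / 2\<close>
      by (intro geodesics_agree[of "f x" m x "f m" "f (f x)"]) (simp_all add: dist_commute e_def d_def)
    then show False using False by metis
  qed
  obtain p where p: "dist x p = e" "dist p (f x) = d - e"
    using point_between_exists[of e x "f x"] e e0 d by (auto simp: d_def)
  obtain q where q: "dist x q = d - e" "dist q (f x) = e"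
    using point_between_exists[of "d - e" x "f x"] e e0 d by (auto simp: d_def)
  have fp: "dist (f x) (f p) = e" "dist (f p) (f (f x)) = d - e"
    using p iso by simp_all
  have "q = f p"
    using q fp ff by (intro geodesics_agree[of "f x" q x "f p" "f (f x)"])
      (simp_all add: dist_commute e_def d_def)
  then have "dist p (f p) = \<bar>dist x p - dist x q\<bar>"
    using dist_points_between[of x p "f x" q] p q by (simp add: d_def)
  then have pf: "dist p (f p) = d - 2 * e" using p q e by simp
  have f2: "dist (f x) (f (f p)) = d - e" "dist (f (f p)) (f (f x)) = e"
  proof -
    show "dist (f (f p)) (f (f x)) = e" using fp(1) iso by (simp add: dist_commute)
    have "dist (f x) (f (f p)) \<le> d - e"
      using dist_triangle[of "f x" "f (f p)" "f p"] fp(1) pf iso[of p "f p"] by simp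
    moreover have "d \<le> dist (f x) (f (f p)) + e"
      using dist_triangle[of "f x" "f (f x)" "f (f p)"] ff \<open>dist (f (f p)) (f (f x)) = e\<close> by simp
    ultimately show "dist (f x) (f (f p)) = d - e" by simp
  qed
  \<comment> \<open>Seen from \<open>f x\<close>, \<open>p\<close> shares more than \<open>e\<close>
    with \<open>x\<close>, and \<open>f (f p)\<close> more than \<open>e\<close> with
    \<open>f (f x)\<close>. As \<open>x\<close> and \<open>f (f x)\<close> share only
    \<open>e\<close>, the points \<open>p\<close> and \<open>f (f p)\<close> share at most
    \<open>e\<close>.\<close>
  have "gromov_product (f x) x p = d - e" "gromov_product (f x) (f (f p)) (f (f x)) = d - e"
    using p f2 ff by (simp_all add: gromov_product_def d_def dist_commute)
  then have "gromov_product (f x) p (f (f p)) \<le> e"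
    using gromov_product_hyperbolic[of "f x" x p "f (f p)"] 
      gromov_product_hyperbolic[of "f x" x "f (f p)" "f (f x)"] e
    unfolding e_def[symmetric] by linarith
  then have "dist p (f (f p)) \<ge> 2 * dist p (f p)"
    using p f2 pf by (simp add: gromov_product_def dist_commute)
  then have "dist p (f (f p)) = 2 * dist p (f p)"
    using dist_triangle[of p "f (f p)" "f p"] iso[of p "f p"] by simp
  then show thesis using that(2)[of p] False by blast
qed

text \<open>Alignment of three consecutive points propagates: the four-point condition on
  \<open>P 0\<close> and three consecutive points excludes backtracking. The induction therefore
  carries two consecutive distances.\<close>

lemma aligned_orbit_dist:
  fixes P :: "int \<Rightarrow> 'a::real_tree"
  assumes shift: "\<And>i j. dist (P (i + 1)) (P (j + 1)) = dist (P i) (P j)"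
    and pos: "dist (P 0) (P 1) > 0" and two: "dist (P 0) (P 2) = 2 * dist (P 0) (P 1)"
  shows "dist (P i) (P j) = \<bar>of_int i - of_int j\<bar> * dist (P 0) (P 1)"
proof -
  define \<tau> where "\<tau> = dist (P 0) (P 1)"
  have const: "dist (P k) (P (k + m)) = dist (P 0) (P m)" for k m
  proof (induction k rule: int_induct[where k = 0])
    case (step1 i)
    then show ?case using shift[of i "i + m"] by (simp add: algebra_simps)
  next
    case (step2 i)
    then show ?case using shift[of "i - 1" "i - 1 + m"] by (simp add: algebra_simps)
  qed simp
  have n: "dist (P 0) (P (int n)) = real n * \<tau> \<and> dist (P 0) (P (int n + 1)) = (real n + 1) * \<tau>" for n
  proof (induction n)
    case (Suc n)
    let ?a = "P 0" and ?b = "P (int n)" and ?c = "P (int n + 1)" and ?d = "P (int n + 2)"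
    have bc: "dist ?b ?c = \<tau>" "dist ?b ?d = 2 * \<tau>" "dist ?c ?d = \<tau>"
      using const[of "int n" 1] const[of "int n" 2] const[of "int n + 1" 1] two
      by (simp_all add: \<tau>_def add.assoc)
    have "dist ?a ?d \<ge> (real n + 2) * \<tau>"
      using four_point[of ?a ?c ?b ?d] Suc bc pos
      by (auto simp: max_def dist_commute algebra_simps \<tau>_def[symmetric] split: if_splits)
    moreover have "dist ?a ?d \<le> (real n + 2) * \<tau>"
      using dist_triangle[of ?a ?d ?c] Suc bc by (simp add: algebra_simps)
    ultimately show ?case using Suc by (simp add: algebra_simps)
  qed (simp add: \<tau>_def)
  have le: "dist (P i) (P j) = (of_int j - of_int i) * \<tau>" if "i \<le> j" for i j
    using const[of i "j - i"] n[of "nat (j - i)"] that by simp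
  show ?thesis
    using le[of i j] le[of j i] by (cases "i \<le> j") (auto simp: \<tau>_def dist_commute)
qed

text \<open>The axis is the union of the segments between consecutive orbit points. Its point
  \<open>l t\<close> is chosen by its distances to all \<open>P k\<close>, which avoids gluing
  parametrisations.\<close>

lemma axis_exists:
  fixes f :: "'a::real_tree \<Rightarrow> 'a" and P :: "int \<Rightarrow> 'a"
  assumes iso: "\<And>x y. dist (f x) (f y) = dist x y" and P: "\<And>k. f (P k) = P (k + 1)"
    and pos: "dist (P 0) (P 1) > 0" and two: "dist (P 0) (P 2) = 2 * dist (P 0) (P 1)"
  obtains l where "isometric_embedding_on UNIV l" "\<And>t. f (l t) = l (t + dist (P 0) (P 1))"
proof -
  define \<tau> where "\<tau> = dist (P 0) (P 1)"
  have \<tau>: "\<tau> > 0" using pos by (simp add: \<tau>_def)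
  have PP: "dist (P i) (P j) = \<bar>of_int i * \<tau> - of_int j * \<tau>\<bar>" for i j
  proof -
    have "dist (P i) (P j) = \<bar>(of_int i - of_int j) * \<tau>\<bar>"
      using aligned_orbit_dist[of P i j] pos two iso \<tau> 
      by (simp add: \<tau>_def abs_mult flip: P)
    then show ?thesis by (simp add: left_diff_distrib)
  qed
  have bound: "\<exists>k. of_int k * \<tau> \<le> t \<and> t \<le> (of_int k + 1) * \<tau>" for t
    using floor_divide_lower[OF \<tau>, of t] floor_divide_upper[OF \<tau>, of t]
    by (intro exI[of _ "\<lfloor>t / \<tau>\<rfloor>"]) auto
  have "\<exists>z. \<forall>k. dist z (P k) = \<bar>t - of_int k * \<tau>\<bar>" for t
  proof -
    obtain i where i: "of_int i * \<tau> \<le> t" "t \<le> (of_int i + 1) * \<tau>" using bound by blast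
    have "dist (P i) (P (i + 1)) = \<tau>" using PP[of i "i + 1"] \<tau> by (simp add: algebra_simps)
    then obtain z where z: "dist (P i) z = t - of_int i * \<tau>" "dist z (P (i + 1)) = (of_int i + 1) * \<tau> - t"
      using point_between_exists[of "t - of_int i * \<tau>" "P i" "P (i + 1)"] i
      by (auto simp: algebra_simps)
    have "dist z (P k) = \<bar>t - of_int k * \<tau>\<bar>" for k
    proof (cases "k \<le> i")
      case True
      then have "of_int k * \<tau> \<le> of_int i * \<tau>" using \<tau> by simp
      then show ?thesis
        using dist_triangle[of z "P k" "P i"] dist_triangle[of "P (i + 1)" "P k" z] z i 
          PP[of i k] PP[of "i + 1" k] by (simp add: dist_commute algebra_simps)
    next
      case False
      then have "of_int (i + 1) * \<tau> \<le> of_int k * \<tau>" using \<tau> by (intro mult_right_mono) (simp_all flip: of_int_le_iff)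
      then show ?thesis
        using dist_triangle[of z "P k" "P (i + 1)"] dist_triangle[of "P i" "P k" z] z i 
          PP[of i k] PP[of "i + 1" k] by (simp add: dist_commute algebra_simps)
    qed
    then show ?thesis by blast
  qed
  then obtain l where l: "\<And>t k. dist (l t) (P k) = \<bar>t - of_int k * \<tau>\<bar>" by metis
  \<comment> \<open>Points with such distances to all \<open>P k\<close> lie on a common segment
    between two orbit points, which determines their mutual distance. With \<open>s = t\<close> they
    coincide.\<close>
  have unique: "dist u v = t - s"
    if "s \<le> t" "\<And>k. dist u (P k) = \<bar>s - of_int k * \<tau>\<bar>" "\<And>k. dist v (P k) = \<bar>t - of_int k * \<tau>\<bar>" for u v s t
  proof -
    obtain i j where ij: "of_int i * \<tau> \<le> s" "t \<le> (of_int j + 1) * \<tau>"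
      using bound by blast
    have "dist (P i) u + dist u (P (j + 1)) = dist (P i) (P (j + 1))"
      "dist (P i) v + dist v (P (j + 1)) = dist (P i) (P (j + 1))"
      using that ij by (simp_all add: dist_commute[of "P i"] PP)
    from dist_points_between[OF this] show ?thesis
      using that ij by (simp add: dist_commute[of "P i"])
  qed
  have "isometric_embedding_on UNIV l"
    unfolding isometric_embedding_on_def
  proof (intro ballI)
    fix s t
    show "dist (l s) (l t) = dist s t"
      using unique[OF _ l l, of s t] unique[OF _ l l, of t s]
      by (cases "s \<le> t") (auto simp: dist_real_def dist_commute)
  qed
  moreover have "f (l t) = l (t + \<tau>)" for t
  proof -
    have "dist (f (l t)) (P k) = \<bar>t + \<tau> - of_int k * \<tau>\<bar>" for k
      using iso[of "l t" "P (k - 1)"] P[of "k - 1"] l[of t "k - 1"] by (simp add: algebra_simps)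
    from unique[OF _ this l, of "t + \<tau>"] show ?thesis by simp
  qed
  ultimately show thesis using that by (simp add: \<tau>_def)
qed

section \<open>Ends of rays\<close>

lemma gromov_equivalent_iff:
  "gromov_equivalent s t \<longleftrightarrow>
     (\<forall>p C. \<exists>N. \<forall>i\<ge>N. \<forall>j\<ge>N. C \<le> gromov_product p (s i) (t j))"
  unfolding gromov_equivalent_def filterlim_at_top eventually_prod_sequentially by (simp, meson)

lemma gromov_product_commute: "gromov_product p x y = gromov_product p y x"
  by (simp add: gromov_product_def dist_commute)

lemma gromov_equivalent_sym: "gromov_equivalent s t \<Longrightarrow> gromov_equivalent t s"
  unfolding gromov_equivalent_iff by (metis gromov_product_commute)

lemma gromov_equivalent_trans:
  fixes s t u :: "nat \<Rightarrow> 'a::real_tree"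
  assumes "gromov_equivalent s t" "gromov_equivalent t u"
  shows "gromov_equivalent s u"
  unfolding gromov_equivalent_iff
proof (intro allI)
  fix p :: 'a and C
  obtain M N where "\<forall>i\<ge>M. \<forall>j\<ge>M. C \<le> gromov_product p (s i) (t j)"
    "\<forall>i\<ge>N. \<forall>j\<ge>N. C \<le> gromov_product p (t i) (u j)"
    using assms unfolding gromov_equivalent_iff by blast
  then have "C \<le> gromov_product p (s i) (t (max M N))" "C \<le> gromov_product p (t (max M N)) (u j)"
    if "i \<ge> max M N" "j \<ge> max M N" for i j
    using that by simp_all
  then have "C \<le> gromov_product p (s i) (u j)" if "i \<ge> max M N" "j \<ge> max M N" for i j
    using gromov_product_hyperbolic[of p "s i" "t (max M N)" "u j"] that by fastforce
  then show "\<exists>N. \<forall>i\<ge>N. \<forall>j\<ge>N. C \<le> gromov_product p (s i) (u j)" by blast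
qed

lemma gromov_equivalent_isometry:
  assumes "\<And>x y. dist (f x) (f y) = dist x y" "surj f" "gromov_equivalent s t"
  shows "gromov_equivalent (f \<circ> s) (f \<circ> t)"
  unfolding gromov_equivalent_iff
proof (intro allI)
  fix p C
  obtain q where "p = f q" using assms(2) by blast
  then show "\<exists>N. \<forall>i\<ge>N. \<forall>j\<ge>N. C \<le> gromov_product p ((f \<circ> s) i) ((f \<circ> t) j)"
    using assms(3) by (simp add: gromov_equivalent_iff gromov_product_def assms(1))
qed

text \<open>Distances along the ray make the product at least the minimum of \<open>i + c\<close>
  and \<open>j\<close>, up to the constant \<open>dist p (r 0)\<close>. With \<open>f = id\<close>
  and \<open>c = 0\<close> this shows that a ray converges at infinity.\<close>

lemma gromov_equivalent_translated_ray:
  fixes r :: "real \<Rightarrow> 'a::metric_space"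
  assumes r: "isometric_embedding_on {0..} r" and f: "\<And>t. t \<ge> a \<Longrightarrow> f (r t) = r (t + c)"
  shows "gromov_equivalent (\<lambda>n. f (r (real n))) (\<lambda>n. r (real n))"
  unfolding gromov_equivalent_iff
proof (intro allI)
  fix p C
  define N where "N = nat \<lceil>\<bar>a\<bar> + \<bar>c\<bar> + \<bar>C\<bar> + dist p (r 0)\<rceil>"
  have N: "real N \<ge> \<bar>a\<bar> + \<bar>c\<bar> + \<bar>C\<bar> + dist p (r 0)"
    by (simp add: N_def)
  have "C \<le> gromov_product p (f (r (real i))) (r (real j))" if "i \<ge> N" "j \<ge> N" for i j
  proof -
    have ij: "real i \<ge> real N" "real j \<ge> real N" using that by simp_all
    have iso: "dist (r s) (r t) = \<bar>s - t\<bar>" if "s \<ge> 0" "t \<ge> 0" for s t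
      using r that by (simp add: isometric_embedding_on_def dist_real_def)
    have ge: "real i + c \<ge> 0" "real i \<ge> a" "real j \<ge> 0"
      using ij N zero_le_dist[of p "r 0"] by linarith+
    have "dist (r 0) (r (real i + c)) = real i + c" "dist (r 0) (r (real j)) = real j"
      using iso[of 0 "real i + c"] iso[of 0 "real j"] ge by simp_all
    moreover have "dist (r (real i + c)) (r (real j)) = \<bar>real i + c - real j\<bar>"
      using iso ge by simp
    moreover have "dist (r 0) (r (real i + c)) \<le> dist p (r 0) + dist p (r (real i + c))"
      "dist (r 0) (r (real j)) \<le> dist p (r 0) + dist p (r (real j))"
      by (rule dist_triangle3)+
    ultimately have "2 * C \<le> dist p (r (real i + c)) + dist p (r (real j)) - dist (r (real i + c)) (r (real j))"
      using ij N by linarith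
    then show ?thesis
      using f[of "real i"] ge by (simp add: gromov_product_def)
  qed
  then show "\<exists>N. \<forall>i\<ge>N. \<forall>j\<ge>N. C \<le> gromov_product p (f (r (real i))) (r (real j))" by blast
qed

text \<open>The boundary point represented by the integer points of the ray, spelled out as an
  equivalence class.\<close>

definition ray_end :: "(real \<Rightarrow> 'a::metric_space) \<Rightarrow> (nat \<Rightarrow> 'a) set" where
  "ray_end r = {s. converges_at_infinity s \<and> gromov_equivalent (\<lambda>n. r (real n)) s}"

lemma ray_end_in_gromov_boundary:
  assumes "isometric_embedding_on {0..} r"
  shows "ray_end r \<in> gromov_boundary"
proof -
  let ?s = "\<lambda>n. r (real n)"
  let ?R = "{(s, t). converges_at_infinity s \<and> converges_at_infinity t \<and> gromov_equivalent s t}"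
  have "converges_at_infinity ?s"
    using gromov_equivalent_translated_ray[OF assms, of 0 id 0] by (simp add: converges_at_infinity_def)
  then have eq: "ray_end r = ?R `` {?s}" and "?s \<in> {s. converges_at_infinity s}"
    by (auto simp: ray_end_def)
  then show ?thesis
    unfolding gromov_boundary_def eq by (intro quotientI)
qed

section \<open>Ping-pong\<close>

text \<open>The evaluation map of the free group sending the generator \<open>x\<close> to
  \<open>c x\<close>, defined on all words so that it can be shown to be unchanged by
  cancellation.\<close>

definition word_value :: "('g, 'm) monoid_scheme \<Rightarrow> ('x \<Rightarrow> 'g) \<Rightarrow> ('x \<times> bool) list \<Rightarrow> 'g" where
  "word_value G c w =
     foldr (\<lambda>x y. (if snd x then c (fst x) else inv\<^bsub>G\<^esub> c (fst x)) \<otimes>\<^bsub>G\<^esub> y) w \<one>\<^bsub>G\<^esub>"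

lemma word_value_Nil [simp]: "word_value G c [] = \<one>\<^bsub>G\<^esub>"
  by (simp add: word_value_def)

lemma word_value_Cons [simp]:
  "word_value G c (x # w) =
     (if snd x then c (fst x) else inv\<^bsub>G\<^esub> c (fst x)) \<otimes>\<^bsub>G\<^esub> word_value G c w"
  by (simp add: word_value_def)

context group
begin

lemma word_value_closed: "range c \<subseteq> carrier G \<Longrightarrow> word_value G c w \<in> carrier G"
  by (induction w) (auto simp: image_subset_iff)

lemma word_value_append:
  "range c \<subseteq> carrier G \<Longrightarrow> word_value G c (u @ w) = word_value G c u \<otimes> word_value G c w"
  by (induction u) (auto simp: image_subset_iff word_value_closed m_assoc)

lemma word_value_reduced_cons:
  assumes c: "range c \<subseteq> carrier G"
  shows "word_value G c (reduced_cons x w) = word_value G c (x # w)"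
proof (cases w)
  case (Cons y v)
  have cl: "c i \<in> carrier G" for i using c by auto
  have "word_value G c (x # inv_letter x # v) = word_value G c v"
    using cl word_value_closed[OF c, of v]
    by (cases "snd x") (simp_all add: inv_letter_def flip: m_assoc)
  then show ?thesis using Cons by auto
qed simp

lemma word_value_foldr_reduced_cons:
  assumes "range c \<subseteq> carrier G"
  shows "word_value G c (foldr reduced_cons u w) = word_value G c u \<otimes> word_value G c w"
  using assms
  by (induction u)
    (auto simp: word_value_reduced_cons word_value_closed m_assoc image_subset_iff)

lemma word_value_image:
  assumes c: "range c \<subseteq> carrier G"
  shows "word_value G c ` {w. reduced_word w} = generate G (range c)"
proof (intro equalityI subsetI)
  fix g assume "g \<in> generate G (range c)"
  then show "g \<in> word_value G c ` {w. reduced_word w}"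
  proof induction
    case one
    then show ?case by (intro image_eqI[of _ _ "[]"]) simp_all
  next
    case (incl h)
    then obtain i where "h = c i" by auto
    then show ?case using c
      by (intro image_eqI[of _ _ "[(i, True)]"]) (auto simp: reduced_word_Cons image_subset_iff)
  next
    case (inv h)
    then obtain i where "h = c i" by auto
    then show ?case using c
      by (intro image_eqI[of _ _ "[(i, False)]"]) (auto simp: reduced_word_Cons image_subset_iff)
  next
    case (eng g h)
    then obtain u w where "reduced_word u" "g = word_value G c u" "reduced_word w" "h = word_value G c w"
      by auto
    then show ?case using word_value_foldr_reduced_cons[OF c, of u w]
      by (intro image_eqI[of _ _ "foldr reduced_cons u w"]) (auto simp: reduced_word_foldr)
  qed
next
  fix g assume "g \<in> word_value G c ` {w. reduced_word w}"
  then obtain w where "g = word_value G c w" by blast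
  moreover have "word_value G c w \<in> generate G (range c)"
    by (induction w) (auto intro: generate.intros)
  ultimately show "g \<in> generate G (range c)" by simp
qed

lemma subgroup_generated_iso_free_group:
  fixes c :: "'x \<Rightarrow> 'a"
  assumes c: "range c \<subseteq> carrier G"
    and nontrivial: "\<And>w. reduced_word w \<Longrightarrow> w \<noteq> [] \<Longrightarrow> word_value G c w \<noteq> \<one>"
  shows "subgroup_generated G (range c) \<cong> free_group (UNIV :: 'x set)"
proof -
  let ?F = "free_group (UNIV :: 'x set)" and ?H = "subgroup_generated G (range c)"
  have F: "carrier ?F = {w. reduced_word w}" "mult ?F = foldr reduced_cons" "one ?F = []"
    by (auto simp: free_group_def)
  have H: "carrier ?H = generate G (range c)" "mult ?H = mult G" "one ?H = \<one>"
    using c by (auto simp: subgroup_generated_def Int_absorb1)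
  note image = word_value_image[OF c]
  have gen: "word_value G c w \<in> generate G (range c)" if "reduced_word w" for w
    using image that by blast
  have hom: "word_value G c \<in> hom ?F ?H"
    by (rule homI) (simp_all add: F H gen word_value_foldr_reduced_cons[OF c])
  interpret group_hom ?F ?H "word_value G c"
    by (intro group_hom.intro group_hom_axioms.intro group_free_group group_subgroup_generated hom)
  have "inj_on (word_value G c) (carrier ?F)"
    using nontrivial by (subst inj_on_one_iff) (auto simp: F H)
  then have "word_value G c \<in> iso ?F ?H"
    using hom image by (simp add: iso_def bij_betw_def F H)
  then show ?thesis
    using group.iso_sym[OF group_free_group] is_isoI by blast
qed

end

text \<open>Besides the group, only the two action identities are required, so the same locale
  serves \<open>\<phi>\<close> on the tree and \<open>boundary_action \<phi>\<close> on sets of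
  sequences.\<close>

locale group_acting = group G for G :: "('g, 'm) monoid_scheme" (structure) +
  fixes \<phi> :: "'g \<Rightarrow> 'a \<Rightarrow> 'a"
  assumes act_one [simp]: "\<phi> \<one> x = x"
    and act_mult: "g \<in> carrier G \<Longrightarrow> h \<in> carrier G \<Longrightarrow> \<phi> (g \<otimes> h) x = \<phi> g (\<phi> h x)"
begin

lemma act_inv [simp]:
  assumes "g \<in> carrier G"
  shows "\<phi> (inv g) (\<phi> g x) = x" "\<phi> g (\<phi> (inv g) x) = x"
  using act_mult[of "inv g" g x] act_mult[of g "inv g" x] assms by simp_all

lemma surj_act: "g \<in> carrier G \<Longrightarrow> surj (\<phi> g)"
  by (metis act_inv(2) surjI)

lemma act_int_pow_fixed:
  assumes "g \<in> carrier G" "\<phi> g x = x"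
  shows "\<phi> (g [^] (k::int)) x = x"
proof (induction k rule: int_induct[where k = 0])
  case (step1 i)
  then show ?case using assms by (simp add: int_pow_mult act_mult)
next
  case (step2 i)
  have "\<phi> (g [^] (i - 1) \<otimes> g) x = \<phi> (g [^] i) x"
    using assms int_pow_mult[of g "i - 1" 1] by simp
  then show ?case using assms step2 by (simp add: act_mult)
qed simp

lemma subgroup_stabilizer: "subgroup (stabilizer G \<phi> x) G"
proof (rule subgroupI)
  show "stabilizer G \<phi> x \<noteq> {}"
    by (force simp: stabilizer_def)
  show "inv g \<in> stabilizer G \<phi> x" if "g \<in> stabilizer G \<phi> x" for g
    using that act_inv(1)[of g x] by (simp add: stabilizer_def)
qed (auto simp: stabilizer_def act_mult)

text \<open>A reduced word with the same generator at both ends moves some point from one side of \<open>A\<close> to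
  the other. Any other reduced word \<open>w\<close> with first letter \<open>x\<close> is conjugate to \<open>x w x\<^sup>-\<^sup>1\<close>, which is
  reduced and has the same generator at both ends.\<close>

lemma ping_pong:
  assumes ab: "a \<in> carrier G" "b \<in> carrier G"
    and a: "\<And>(k::int) z. k \<noteq> 0 \<Longrightarrow> z \<notin> A \<Longrightarrow> \<phi> (a [^] k) z \<in> A"
    and b: "\<And>(k::int) z. k \<noteq> 0 \<Longrightarrow> z \<in> A \<Longrightarrow> \<phi> (b [^] k) z \<notin> A"
  shows "subgroup_generated G {a, b} \<cong> free_group_2"
proof -
  define c where "c i = (if i then a else b)" for i
  \<comment> \<open>Nonzero powers of \<open>c i\<close> move \<open>side i\<close> into its
    complement, which is the side of the other generator; this makes the two hypotheses
    symmetric.\<close>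
  define side where "side i = (if i then - A else A)" for i
  have side_not: "z \<in> side (\<not> i) \<longleftrightarrow> z \<notin> side i" for i z
    by (simp add: side_def)
  have c: "c i \<in> carrier G" for i using ab by (simp add: c_def)
  then have rc: "range c \<subseteq> carrier G" by auto
  have play: "\<phi> (c i [^] k) z \<notin> side i" if "k \<noteq> 0" "z \<in> side i" for i and k :: int and z
    using that a b by (auto simp: c_def side_def)
  have ne: "\<exists>z. z \<in> side i" for i
  proof -
    fix z
    show ?thesis using play[of 1 z "\<not> i"] side_not[of _ i] by (metis zero_neq_one)
  qed
  \<comment> \<open>The leading letters with the same generator are collected into one power
    \<open>k\<close>. Its sign agrees with the first letter, so prepending a letter with the same
    generator to a reduced word cannot make the exponent 0.\<close>
  have word: "\<exists>k y. k \<noteq> 0 \<and> (snd x \<longleftrightarrow> k > 0) \<and> y \<in> side (fst x) \<and>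
      \<phi> (word_value G c (x # w)) z = \<phi> (c (fst x) [^] (k::int)) y"
    if "reduced_word (x # w)" "z \<in> side (fst (last (x # w)))" for x w z
    using that
  proof (induction w arbitrary: x)
    case Nil
    then show ?case using c
      by (intro exI[of _ "if snd x then 1 else -1"] exI[of _ z]) (simp add: int_pow_neg)
  next
    case (Cons x' w)
    have "reduced_word (x' # w)" "z \<in> side (fst (last (x' # w)))"
      using Cons.prems by (simp_all only: reduced_word_Cons[of x] last_ConsR list.simps simp_thms)
    from Cons.IH[OF this] obtain k y where k: "k \<noteq> 0" "snd x' \<longleftrightarrow> k > 0" and y: "y \<in> side (fst x')"
      and eq: "\<phi> (word_value G c (x' # w)) z = \<phi> (c (fst x') [^] (k::int)) y"
      by blast
    let ?e = "if snd x then 1 else -1 :: int"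
    have step: "\<phi> (word_value G c (x # x' # w)) z = \<phi> (c (fst x) [^] ?e) (\<phi> (c (fst x') [^] k) y)"
      using eq c word_value_closed[OF rc] by (simp add: int_pow_neg act_mult)
    show ?case
    proof (cases "fst x' = fst x")
      case True
      moreover have "x' \<noteq> inv_letter x"
        using Cons.prems(1) by (simp add: reduced_word_Cons)
      ultimately have "snd x = snd x'"
        by (auto simp: inv_letter_def prod_eq_iff)
      then show ?thesis
        using k y step c True
        by (intro exI[of _ "?e + k"] exI[of _ y]) (auto simp: int_pow_mult act_mult)
    next
      case False
      then have "fst x = (\<not> fst x')" by simp
      then have "\<phi> (c (fst x') [^] k) y \<in> side (fst x)"
        using play[OF k(1) y] side_not by simp
      then show ?thesis
        using step by (intro exI[of _ ?e] exI[of _ "\<phi> (c (fst x') [^] k) y"]) simp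
    qed
  qed
  have same: "word_value G c w \<noteq> \<one>"
    if red: "reduced_word w" and "w \<noteq> []" and ends: "fst (hd w) = fst (last w)" for w
  proof
    assume one: "word_value G c w = \<one>"
    obtain x v where w: "w = x # v" using \<open>w \<noteq> []\<close> by (cases w) auto
    obtain z where z: "z \<in> side (fst (last w))" using ne by blast
    then obtain k y where "k \<noteq> 0" "y \<in> side (fst x)" "\<phi> (word_value G c w) z = \<phi> (c (fst x) [^] (k::int)) y"
      using word[of x v z] red z unfolding w by metis
    then have "z \<notin> side (fst x)" using play[of k y "fst x"] one by (metis act_one)
    then show False using z ends w by simp
  qed
  have "word_value G c w \<noteq> \<one>" if w: "reduced_word w" "w \<noteq> []" for w
  proof (cases "fst (hd w) = fst (last w)")
    case False
    define x where "x = hd w"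
    let ?w = "x # w @ [inv_letter x]"
    have snoc: "reduced_word (v @ [y])" if "reduced_word v" "v \<noteq> []" "fst (last v) \<noteq> fst y" for v and y :: "bool \<times> bool"
      using that
    proof (induction v)
      case (Cons u v)
      show ?case
      proof (cases "v = []")
        case True
        then show ?thesis using Cons.prems by (auto simp: reduced_word_Cons inv_letter_def)
      next
        case False
        then show ?thesis using Cons by (simp add: reduced_word_Cons)
      qed
    qed simp
    have "x \<noteq> inv_letter x" by (simp add: inv_letter_def prod_eq_iff)
    then have "reduced_word ?w"
      using w False snoc[of w "inv_letter x"]
      by (simp add: reduced_word_Cons x_def inv_letter_def)
    then have "word_value G c ?w \<noteq> \<one>"
      by (intro same) (auto simp: inv_letter_def)
    moreover have "word_value G c ?w = \<one>" if "word_value G c w = \<one>"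
      using that c by (simp add: word_value_append[OF rc] inv_letter_def)
    ultimately show ?thesis by blast
  qed (use w same in blast)
  then have "subgroup_generated G (range c) \<cong> free_group_2"
    by (intro subgroup_generated_iso_free_group rc)
  moreover have "range c = {a, b}"
    by (simp add: c_def UNIV_bool insert_commute)
  ultimately show ?thesis by simp
qed

end

section \<open>Actions on real trees\<close>

definition power_pair :: "('g, 'm) monoid_scheme \<Rightarrow> 'g \<Rightarrow> 'g \<Rightarrow> bool" where
  "power_pair G g h \<longleftrightarrow> (\<exists>n::nat. n \<ge> 1 \<and>
     ((g [^]\<^bsub>G\<^esub> n) \<otimes>\<^bsub>G\<^esub> (h [^]\<^bsub>G\<^esub> n) = (h [^]\<^bsub>G\<^esub> n) \<otimes>\<^bsub>G\<^esub> (g [^]\<^bsub>G\<^esub> n) \<or>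
      subgroup_generated G {g [^]\<^bsub>G\<^esub> n, h [^]\<^bsub>G\<^esub> n} \<cong> free_group_2))"

lemma power_alternative_iff:
  "power_alternative G \<longleftrightarrow> (\<forall>g\<in>carrier G. \<forall>h\<in>carrier G. power_pair G g h)"
  by (simp add: power_alternative_def power_pair_def)

lemma power_pair_sym: "power_pair G g h \<Longrightarrow> power_pair G h g"
  unfolding power_pair_def by (metis insert_commute)

text \<open>The alternative in \<open>H\<close> for the powers with exponent \<open>m\<close> yields
  some \<open>n\<close>, and \<open>m * n\<close> serves in \<open>G\<close>, because powers and
  generated subgroups agree in both groups.\<close>

lemma (in group) power_pair_if_powers_in_subgroup:
  assumes H: "subgroup H G" "power_alternative (G\<lparr>carrier := H\<rparr>)"
    and m: "m \<ge> (1::nat)" and gh: "g \<in> carrier G" "h \<in> carrier G" "g [^] m \<in> H" "h [^] m \<in> H"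
  shows "power_pair G g h"
proof -
  let ?H = "G\<lparr>carrier := H\<rparr>"
  have "power_pair ?H (g [^] m) (h [^] m)"
    using H(2) gh by (simp add: power_alternative_iff)
  then obtain n :: nat where n: "n \<ge> 1" and *:
    "(g [^] (m * n)) \<otimes> (h [^] (m * n)) = (h [^] (m * n)) \<otimes> (g [^] (m * n)) \<or>
      subgroup_generated ?H {g [^] (m * n), h [^] (m * n)} \<cong> free_group_2"
    using gh by (auto simp: power_pair_def nat_pow_pow simp flip: nat_pow_consistent)
  have "(g [^] m) [^] n \<in> H" "(h [^] m) [^] n \<in> H"
    using gh subgroup_is_submonoid[OF H(1)] 
    by (metis H(1) int_pow_int subgroup_int_pow_closed)+
  then have in_H: "{g [^] (m * n), h [^] (m * n)} \<subseteq> H"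
    using gh by (simp add: nat_pow_pow)
  have "H \<subseteq> carrier G" using H(1) by (rule subgroup.subset)
  then have "subgroup_generated ?H {g [^] (m * n), h [^] (m * n)} =
      subgroup_generated G {g [^] (m * n), h [^] (m * n)}"
    using generate_consistent[OF in_H H(1)] in_H
    by (simp add: subgroup_generated_def Int_absorb1 subset_iff)
  moreover have "m * n \<ge> 1" using m n by simp
  ultimately show ?thesis
    using * unfolding power_pair_def by (intro exI[of _ "m * n"]) simp
qed

locale tree_action = group_acting G \<phi>
  for G :: "('g, 'm) monoid_scheme" (structure) and \<phi> :: "'g \<Rightarrow> 'a::real_tree \<Rightarrow> 'a" +
  assumes act_dist [simp]: "g \<in> carrier G \<Longrightarrow> dist (\<phi> g x) (\<phi> g y) = dist x y"
begin

lemma power_pair_if_ping_pong: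
  assumes gh: "g \<in> carrier G" "h \<in> carrier G" and N: "N \<ge> 1"
    and g: "\<And>(k::int) z. k \<noteq> 0 \<Longrightarrow> z \<notin> A \<Longrightarrow> \<phi> (g [^] (int N * k)) z \<in> A"
    and h: "\<And>(k::int) z. k \<noteq> 0 \<Longrightarrow> z \<in> A \<Longrightarrow> \<phi> (h [^] (int N * k)) z \<notin> A"
  shows "power_pair G g h"
proof -
  have "(x [^] N) [^] k = x [^] (int N * k)" if "x \<in> carrier G" for x and k :: int
    using that by (metis int_pow_int int_pow_pow)
  then have "subgroup_generated G {g [^] N, h [^] N} \<cong> free_group_2"
    using gh g h by (intro ping_pong[where A = A]) simp_all
  then show ?thesis using N unfolding power_pair_def by blast
qed

text \<open>This turns integer exponents \<open>j\<close> and \<open>k\<close> of two elements into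
  one natural exponent for both.\<close>

lemma act_pow_fixed:
  assumes "g \<in> carrier G" "\<phi> (g [^] (j::int)) x = x"
  shows "\<phi> (g [^] nat (\<bar>j\<bar> * \<bar>k\<bar>)) x = x"
proof -
  have "int (nat (\<bar>j\<bar> * \<bar>k\<bar>)) = \<bar>j\<bar> * \<bar>k\<bar>"
    by simp
  also have "\<dots> = j * (sgn j * \<bar>k\<bar>)"
    by (simp only: abs_sgn[of j] mult.assoc)
  finally have "g [^] nat (\<bar>j\<bar> * \<bar>k\<bar>) = g [^] (j * (sgn j * \<bar>k\<bar>))"
    by (metis int_pow_int)
  also have "\<dots> = (g [^] j) [^] (sgn j * \<bar>k\<bar>)"
    using assms by (simp add: int_pow_pow)
  finally show ?thesis
    using act_int_pow_fixed[of "g [^] j" x] assms by simp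
qed

section \<open>Two elements with fixed points\<close>

lemma power_pair_elliptic_elliptic:
  assumes gh: "g \<in> carrier G" "h \<in> carrier G" and pq: "\<phi> g p = p" "\<phi> h q = q"
    and stab: "\<And>x. power_alternative (G\<lparr>carrier := stabilizer G \<phi> x\<rparr>)"
  shows "power_pair G g h"
proof (rule ccontr)
  assume no: "\<not> power_pair G g h"
  have no_common: False if "j \<noteq> 0" "k \<noteq> 0" "\<phi> (g [^] (j::int)) x = x" "\<phi> (h [^] (k::int)) x = x" for j k x
  proof -
    let ?n = "nat (\<bar>j\<bar> * \<bar>k\<bar>)"
    have "\<phi> (g [^] ?n) x = x" "\<phi> (h [^] ?n) x = x"
      using act_pow_fixed[of g j x k] act_pow_fixed[of h k x j] gh that by (simp_all add: mult.commute)
    moreover have "?n \<ge> 1"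
      using that by (simp add: Suc_le_eq)
    ultimately have "power_pair G g h"
      using power_pair_if_powers_in_subgroup[OF subgroup_stabilizer stab, of ?n g h x] gh
      by (simp add: stabilizer_def)
    then show False using no by simp
  qed
  \<comment> \<open>\<open>u\<close> is the projection of \<open>z\<close> to the segment from
    \<open>p\<close> to \<open>q\<close>: the geodesics from \<open>p\<close> to \<open>z\<close>
    and to \<open>q\<close> part at distance \<open>gromov_product p z q\<close>.\<close>
  define A where "A = {z. \<exists>u k. dist p u + dist u q = dist p q \<and> dist p u = gromov_product p z q \<and>
      k \<noteq> 0 \<and> \<phi> (g [^] (k::int)) u = u}"
  have gp: "0 \<le> gromov_product x z y \<and> gromov_product x z y \<le> dist x y" for x y z :: 'a
    using dist_triangle[of z y x] dist_triangle[of x z y] by (simp add: gromov_product_def dist_commute)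
  have gp_swap: "gromov_product q z p = dist p q - gromov_product p z q" for z
    by (simp add: gromov_product_def dist_commute field_simps)
  have "power_pair G g h"
  proof (rule power_pair_if_ping_pong[OF gh, of 1 A])
    fix k :: int and z assume k: "k \<noteq> 0" and z: "z \<notin> A"
    let ?f = "\<phi> (g [^] k)"
    show "\<phi> (g [^] (int 1 * k)) z \<in> A"
    proof (rule ccontr)
      assume "\<phi> (g [^] (int 1 * k)) z \<notin> A"
      \<comment> \<open>Up to distance \<open>m\<close> from \<open>p\<close> the geodesics to
        \<open>z\<close>, \<open>?f z\<close> and \<open>q\<close> agree, so \<open>?f\<close> fixes
        the point \<open>u\<close> there. This \<open>u\<close> is the projection of
        \<open>z\<close> or of \<open>?f z\<close>, which puts one of them into
        \<open>A\<close>.\<close>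
      define m where "m = min (gromov_product p z q) (gromov_product p (?f z) q)"
      have m: "0 \<le> m" "m \<le> dist p q"
        using gp[of p z q] gp[of p "?f z" q] by (auto simp: m_def min_def)
      have le: "m \<le> gromov_product p z q" "m \<le> gromov_product p (?f z) q"
        by (simp_all add: m_def)
      obtain u where u: "dist p u = m" "dist u q = dist p q - m"
        using point_between_exists[OF m] .
      have "?f u = u"
        using u le gh pq act_int_pow_fixed[of g p k]
        by (intro isometry_fixes_common_part[of ?f p u q z]) simp_all
      moreover have "m = gromov_product p z q \<or> m = gromov_product p (?f z) q"
        by (auto simp: m_def min_def)
      moreover have "dist p u + dist u q = dist p q" using u by simp
      ultimately have "z \<in> A \<or> ?f z \<in> A"
        using u(1) k unfolding A_def by blast
      then show False using z \<open>\<phi> (g [^] (int 1 * k)) z \<notin> A\<close> by simp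
    qed
  next
    fix k :: int and z assume k: "k \<noteq> 0" and z: "z \<in> A"
    let ?f = "\<phi> (h [^] k)"
    show "\<phi> (h [^] (int 1 * k)) z \<notin> A"
    proof
      assume fz: "\<phi> (h [^] (int 1 * k)) z \<in> A"
      \<comment> \<open>The same argument from \<open>q\<close>: \<open>u\<close> is fixed by a
        nontrivial power of \<open>h\<close> and is the projection of a point of \<open>A\<close>,
        hence also fixed by a nontrivial power of \<open>g\<close>.\<close>
      define m where "m = min (gromov_product q z p) (gromov_product q (?f z) p)"
      have m: "0 \<le> m" "m \<le> dist q p"
        using gp[of q z p] gp[of q "?f z" p] by (auto simp: m_def min_def)
      have le: "m \<le> gromov_product q z p" "m \<le> gromov_product q (?f z) p"
        by (simp_all add: m_def)
      obtain u where u: "dist q u = m" "dist u p = dist q p - m"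
        using point_between_exists[OF m] .
      have fu: "?f u = u"
        using u le gh pq act_int_pow_fixed[of h q k]
        by (intro isometry_fixes_common_part[of ?f q u p z]) simp_all
      have "m = gromov_product q z p \<or> m = gromov_product q (?f z) p"
        by (auto simp: m_def min_def)
      then obtain y where y: "y \<in> A" "m = gromov_product q y p"
        using z fz by auto
      then obtain v j where v: "dist p v + dist v q = dist p q" "dist p v = gromov_product p y q"
        "j \<noteq> 0" "\<phi> (g [^] (j::int)) v = v" by (auto simp: A_def)
      have "dist p u = dist p v"
        using u v y gp_swap[of y] by (simp add: dist_commute)
      moreover have "dist p u + dist u q = dist p q"
        using u by (simp add: dist_commute)
      ultimately have "u = v"
        using dist_points_between[of p u q v] v(1) by simp
      then show False using no_common v fu k by blast
    qed
  qed simp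
  then show False using no by simp
qed

section \<open>Stabilisers of ends\<close>

lemma group_acting_boundary: "group_acting G (boundary_action \<phi>)"
proof unfold_locales
  show "boundary_action \<phi> \<one> \<xi> = \<xi>" for \<xi>
    by (simp add: boundary_action_def comp_def)
  show "boundary_action \<phi> (g \<otimes> h) \<xi> = boundary_action \<phi> g (boundary_action \<phi> h \<xi>)"
    if "g \<in> carrier G" "h \<in> carrier G" for g h \<xi>
    using that by (simp add: boundary_action_def image_image comp_def act_mult)
qed

lemma act_ray_end_subset:
  assumes r: "isometric_embedding_on {0..} r" and g: "g \<in> carrier G"
    and translate: "\<And>t. t \<ge> a \<Longrightarrow> \<phi> g (r t) = r (t + c)"
  shows "boundary_action \<phi> g (ray_end r) \<subseteq> ray_end r"
proof
  fix t assume "t \<in> boundary_action \<phi> g (ray_end r)"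
  then obtain s where s: "converges_at_infinity s" "gromov_equivalent (\<lambda>n. r (real n)) s" "t = \<phi> g \<circ> s"
    by (auto simp: boundary_action_def ray_end_def)
  have "converges_at_infinity t"
    using s g surj_act unfolding converges_at_infinity_def by (auto intro: gromov_equivalent_isometry)
  moreover have "gromov_equivalent (\<phi> g \<circ> (\<lambda>n. r (real n))) t"
    using s g surj_act by (auto intro: gromov_equivalent_isometry)
  moreover have "gromov_equivalent (\<lambda>n. r (real n)) (\<phi> g \<circ> (\<lambda>n. r (real n)))"
    using gromov_equivalent_translated_ray[OF r translate]
    by (auto intro: gromov_equivalent_sym simp: comp_def)
  ultimately show "t \<in> ray_end r"
    using gromov_equivalent_trans by (auto simp: ray_end_def)
qed

text \<open>The inverse translates the ray by \<open>- c\<close> from \<open>a + c\<close> on, so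
  both \<open>g\<close> and \<open>inv g\<close> map the end into itself, which gives
  equality.\<close>

lemma ray_end_stabilized:
  assumes r: "isometric_embedding_on {0..} r" and g: "g \<in> carrier G"
    and translate: "\<And>t. t \<ge> a \<Longrightarrow> \<phi> g (r t) = r (t + c)"
  shows "g \<in> stabilizer G (boundary_action \<phi>) (ray_end r)"
proof -
  interpret boundary: group_acting G "boundary_action \<phi>"
    by (rule group_acting_boundary)
  have "\<phi> (inv g) (r t) = r (t + (- c))" if "t \<ge> a + c" for t
    using translate[of "t - c"] that act_inv(1)[OF g, of "r (t - c)"] by simp
  then have "boundary_action \<phi> (inv g) (ray_end r) \<subseteq> ray_end r"
    using g by (intro act_ray_end_subset[OF r, of _ "a + c" "- c"]) auto
  then have "boundary_action \<phi> g (boundary_action \<phi> (inv g) (ray_end r)) \<subseteq> boundary_action \<phi> g (ray_end r)"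
    unfolding boundary_action_def[of \<phi> g] by (rule image_mono)
  then have "boundary_action \<phi> g (ray_end r) = ray_end r"
    using act_ray_end_subset[OF r g translate] g by auto
  then show ?thesis using g by (simp add: stabilizer_def)
qed

text \<open>The exponent \<open>m\<close> at \<open>h\<close> serves the case where \<open>h\<close>
  has a fixed point and only a power of it is known to fix the ray.\<close>

lemma power_pair_if_common_end:
  assumes boundary: "\<And>\<xi>. \<xi> \<in> gromov_boundary \<Longrightarrow>
      power_alternative (G\<lparr>carrier := stabilizer G (boundary_action \<phi>) \<xi>\<rparr>)"
    and r: "isometric_embedding_on {0..} r" and gh: "g \<in> carrier G" "h \<in> carrier G"
    and m: "m \<ge> (1::nat)"
    and g: "\<And>t. t \<ge> a \<Longrightarrow> \<phi> g (r t) = r (t + c)"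
    and h: "\<And>t. t \<ge> b \<Longrightarrow> \<phi> (h [^] m) (r t) = r (t + d)"
  shows "power_pair G g h"
proof -
  have sub: "subgroup (stabilizer G (boundary_action \<phi>) (ray_end r)) G"
    by (rule group_acting.subgroup_stabilizer[OF group_acting_boundary])
  have "g \<in> stabilizer G (boundary_action \<phi>) (ray_end r)"
    by (rule ray_end_stabilized[OF r gh(1) g])
  then have "g [^] m \<in> stabilizer G (boundary_action \<phi>) (ray_end r)"
    using subgroup_int_pow_closed[OF sub, of g "int m"] by (simp add: int_pow_int)
  moreover have "h [^] m \<in> stabilizer G (boundary_action \<phi>) (ray_end r)"
    using gh h by (intro ray_end_stabilized[OF r]) simp_all
  ultimately show ?thesis
    using power_pair_if_powers_in_subgroup[OF sub boundary[OF ray_end_in_gromov_boundary[OF r]] m gh] by simp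
qed

section \<open>Axes of group elements\<close>

definition axis :: "'g \<Rightarrow> (real \<Rightarrow> 'a) \<Rightarrow> real \<Rightarrow> bool" where
  "axis g l \<tau> \<longleftrightarrow> isometric_embedding_on UNIV l \<and> \<tau> > 0 \<and> (\<forall>t. \<phi> g (l t) = l (t + \<tau>))"

lemma elliptic_or_axis:
  assumes g: "g \<in> carrier G"
  obtains p where "\<phi> g p = p" | l \<tau> where "axis g l \<tau>"
proof -
  consider p where "\<phi> g p = p" | p where "\<phi> g p \<noteq> p" "dist p (\<phi> g (\<phi> g p)) = 2 * dist p (\<phi> g p)"
    using fixed_point_or_aligned_orbit[of "\<phi> g"] g by auto
  then show thesis
  proof cases
    case 2
    let ?P = "\<lambda>k::int. \<phi> (g [^] k) p"
    have P: "\<phi> g (?P k) = ?P (k + 1)" for k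
      using g int_pow_mult[of g 1 k] act_mult[of g "g [^] k" p] by (simp add: add.commute)
    have P012: "?P 0 = p" "?P 1 = \<phi> g p" "?P 2 = \<phi> g (\<phi> g p)"
      using g P[of 1] by simp_all
    then obtain l where "isometric_embedding_on UNIV l" "\<And>t. \<phi> g (l t) = l (t + dist (?P 0) (?P 1))"
      using axis_exists[of "\<phi> g" ?P] g P 2 by auto
    then show thesis using that(2)[of l "dist (?P 0) (?P 1)"] P012 2 by (simp add: axis_def)
  qed (rule that(1))
qed

lemma axis_shift:
  assumes "axis g l \<tau>"
  shows "axis g (\<lambda>t. l (t + s)) \<tau>"
proof -
  have "\<phi> g (l (t + s)) = l (t + \<tau> + s)" for t
    using assms by (simp add: axis_def add.assoc add.commute[of s])
  then show ?thesis
    using assms by (simp add: axis_def isometric_embedding_on_def)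
qed

lemma axis_based_at:
  assumes "axis g l \<tau>"
  obtains m D where "axis g m \<tau>" "\<And>t. dist p (m t) = D + \<bar>t\<bar>" "D \<ge> 0"
proof -
  have "isometric_embedding_on UNIV l" using assms by (simp add: axis_def)
  then have "dist p (l (t + line_projection l p)) = dist p (l (line_projection l p)) + \<bar>t\<bar>" for t
    using dist_line[of l p "t + line_projection l p"] by simp
  then show thesis
    using that axis_shift[OF assms] zero_le_dist by blast
qed

lemma act_int_pow_axis:
  assumes g: "g \<in> carrier G" and l: "axis g l \<tau>"
  shows "\<phi> (g [^] (k::int)) (l t) = l (t + of_int k * \<tau>)"
proof (induction k arbitrary: t rule: int_induct[where k = 0])
  case (step1 i)
  then show ?case
    using l g by (simp add: int_pow_mult act_mult axis_def algebra_simps)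
next
  case (step2 i)
  have "\<phi> (g [^] (i - 1) \<otimes> g) (l (t - \<tau>)) = \<phi> (g [^] i) (l (t - \<tau>))"
    using g int_pow_mult[of g "i - 1" 1] by simp
  then show ?case using l g step2 by (simp add: act_mult axis_def algebra_simps)
qed simp

lemma line_projection_int_pow:
  assumes g: "g \<in> carrier G" and l: "axis g l \<tau>"
  shows "line_projection l (\<phi> (g [^] (k::int)) z) = line_projection l z + of_int k * \<tau>"
proof (rule line_projection_eqI)
  show iso: "isometric_embedding_on UNIV l" using l by (simp add: axis_def)
  fix t
  have "dist (\<phi> (g [^] k) z) (l t) = dist z (l (t - of_int k * \<tau>))"
    using act_int_pow_axis[OF g l, of k "t - of_int k * \<tau>"] act_dist[of "g [^] k" z] g by (metis diff_add_cancel int_pow_closed)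
  then show "dist (\<phi> (g [^] k) z) (l t) =
      dist z (l (line_projection l z)) + \<bar>t - (line_projection l z + of_int k * \<tau>)\<bar>"
    using dist_line[OF iso, of z "t - of_int k * \<tau>"] by (simp add: algebra_simps)
qed

text \<open>The coordinate is shifted by at least \<open>real N * \<tau>\<close>, more than the
  length \<open>2 * R\<close> of the interval.\<close>

lemma axis_leaves_interval:
  assumes g: "g \<in> carrier G" and l: "axis g l \<tau>" and N: "real N * \<tau> > 2 * R"
    and k: "k \<noteq> 0" and z: "\<bar>line_projection l z\<bar> \<le> R"
  shows "\<bar>line_projection l (\<phi> (g [^] (int N * k)) z)\<bar> > R"
proof -
  have "\<tau> > 0" using l by (simp add: axis_def)
  have "1 \<le> \<bar>real_of_int k\<bar>" using k by linarith
  then have "real N * \<tau> * 1 \<le> real N * \<tau> * \<bar>real_of_int k\<bar>"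
    using \<open>\<tau> > 0\<close> by (intro mult_left_mono) simp_all
  also have "\<dots> = \<bar>of_int (int N * k) * \<tau>\<bar>"
    using \<open>\<tau> > 0\<close> by (simp add: abs_mult)
  finally have "2 * R < \<bar>of_int (int N * k) * \<tau>\<bar>"
    using N by linarith
  then show ?thesis
    using z by (simp add: line_projection_int_pow[OF g l])
qed

text \<open>The exponent in \<open>fixed\<close> may depend on \<open>R\<close>. The pointwise
  stabilisers of the initial segments are eventually constant, so a power that fixes a long enough
  segment fixes all longer ones.\<close>

lemma ray_fixed_if_unboundedly_fixed:
  assumes stab: "stabilisation_property G \<phi>" and h: "h \<in> carrier G" "\<phi> h p = p"
    and l: "isometric_embedding_on UNIV l" and D: "\<And>t. dist p (l t) = D + \<bar>t\<bar>" and \<epsilon>: "\<bar>\<epsilon>\<bar> = 1"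
    and fixed: "\<And>R. R \<ge> 0 \<Longrightarrow> \<exists>k::int. k \<noteq> 0 \<and> \<phi> (h [^] k) (l (\<epsilon> * R)) = l (\<epsilon> * R)"
  obtains k :: int where "k \<noteq> 0" "\<And>t. t \<ge> 0 \<Longrightarrow> \<phi> (h [^] k) (l (\<epsilon> * t)) = l (\<epsilon> * t)"
proof -
  define r where "r t = l (\<epsilon> * t)" for t
  have "dist (r s) (r t) = dist s t" for s t
    using l \<epsilon> by (simp add: r_def isometric_embedding_on_def dist_real_def abs_mult flip: right_diff_distrib)
  then have "geodesic {0..real n} r" for n
    by (simp add: geodesic_def isometric_embedding_on_def)
  moreover have "r ` {0..real n} \<subseteq> r ` {0..real (Suc n)}" for n
    by (intro image_mono) simp
  moreover have "(\<lambda>n. emeasure lborel {0..real n}) \<longlonglongrightarrow> \<infinity>"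
    using of_nat_tendsto_top_ennreal by (simp add: ennreal_of_nat_eq_real_of_nat infinity_ennreal_def)
  ultimately have "\<exists>N. \<forall>n\<ge>N. pointwise_stabilizer G \<phi> (r ` {0..real n}) =
      pointwise_stabilizer G \<phi> (r ` {0..real (Suc n)})"
    using stab[unfolded stabilisation_property_def, rule_format, of "\<lambda>n. {0..real n}" "\<lambda>_. r"] by blast
  then obtain N where N: "\<And>n. n \<ge> N \<Longrightarrow> pointwise_stabilizer G \<phi> (r ` {0..real n}) =
      pointwise_stabilizer G \<phi> (r ` {0..real (Suc n)})" by blast
  obtain k :: int where k: "k \<noteq> 0" "\<phi> (h [^] k) (l (\<epsilon> * real N)) = l (\<epsilon> * real N)"
    using fixed[of "real N"] by auto
  have "\<phi> (h [^] k) (r t) = r t" if "t \<in> {0..real N}" for t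
  proof -
    have "dist (\<phi> (h [^] k) x) (\<phi> (h [^] k) y) = dist x y" for x y
      using h by simp
    then show ?thesis
      unfolding r_def
      by (rule isometry_between_rays[OF _ act_int_pow_fixed[OF h] l D \<epsilon> \<epsilon> k(2)]) (use that in auto)
  qed
  then have base: "h [^] k \<in> pointwise_stabilizer G \<phi> (r ` {0..real N})"
    using h by (simp add: pointwise_stabilizer_def)
  have all: "h [^] k \<in> pointwise_stabilizer G \<phi> (r ` {0..real n})" if "n \<ge> N" for n
    using that by (induction n rule: nat_induct_at_least) (use base N in auto)
  have "\<phi> (h [^] k) (l (\<epsilon> * t)) = l (\<epsilon> * t)" if "t \<ge> 0" for t
  proof -
    obtain n where "real n \<ge> t" using real_arch_simple[of t] by blast
    then have "t \<in> {0..real (max n N)}" using that by simp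
    then show ?thesis
      using all[of "max n N"] by (auto simp: pointwise_stabilizer_def r_def)
  qed
  then show thesis using that k by blast
qed

section \<open>An element with an axis and an element with a fixed point\<close>

lemma power_pair_hyperbolic_elliptic:
  assumes stab: "stabilisation_property G \<phi>"
    and boundary: "\<And>\<xi>. \<xi> \<in> gromov_boundary \<Longrightarrow>
      power_alternative (G\<lparr>carrier := stabilizer G (boundary_action \<phi>) \<xi>\<rparr>)"
    and gh: "g \<in> carrier G" "h \<in> carrier G" and "axis g l' \<tau>" and p: "\<phi> h p = p"
  shows "power_pair G g h"
proof (rule ccontr)
  assume no: "\<not> power_pair G g h"
  obtain l D where ax: "axis g l \<tau>" and D: "\<And>t. dist p (l t) = D + \<bar>t\<bar>"
    using axis_based_at[OF \<open>axis g l' \<tau>\<close>] by metis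
  have l: "isometric_embedding_on UNIV l" and \<tau>: "\<tau> > 0" and gl: "\<And>t. \<phi> g (l t) = l (t + \<tau>)"
    using ax by (auto simp: axis_def)
  have h_iso: "dist (\<phi> (h [^] k) x) (\<phi> (h [^] k) y) = dist x y" for k :: int and x y
    using gh by simp
  have hp: "\<phi> (h [^] k) p = p" for k :: int
    using act_int_pow_fixed gh p by blast
  \<comment> \<open>Otherwise a nontrivial power of \<open>h\<close> fixes half of the axis of
    \<open>g\<close> pointwise; its end is also fixed by \<open>g\<close>, and the hypothesis on
    ends applies.\<close>
  have ex: "\<exists>R\<ge>0. \<forall>k::int. k \<noteq> 0 \<longrightarrow> \<phi> (h [^] k) (l (\<epsilon> * R)) \<noteq> l (\<epsilon> * R)" if \<epsilon>: "\<bar>\<epsilon>\<bar> = 1" for \<epsilon>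
  proof (rule ccontr)
    assume "\<not> ?thesis"
    then obtain k :: int where k: "k \<noteq> 0" and fix_ray: "\<And>t. t \<ge> 0 \<Longrightarrow> \<phi> (h [^] k) (l (\<epsilon> * t)) = l (\<epsilon> * t)"
      using ray_fixed_if_unboundedly_fixed[OF stab gh(2) p l D \<epsilon>] by metis
    define m where "m = nat (\<bar>k\<bar> * \<bar>1\<bar>)"
    have "\<epsilon> * \<epsilon> = 1" using \<epsilon> by (auto simp: abs_if split: if_splits)
    then have "\<phi> g (l (\<epsilon> * t)) = l (\<epsilon> * (t + \<epsilon> * \<tau>))" for t
      by (simp add: gl distrib_left flip: mult.assoc)
    moreover have "\<phi> (h [^] m) (l (\<epsilon> * t)) = l (\<epsilon> * (t + 0))" if "t \<ge> 0" for t
      using act_pow_fixed[OF gh(2) fix_ray[OF that], of 1] by (simp add: m_def)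
    moreover have "isometric_embedding_on {0..} (\<lambda>t. l (\<epsilon> * t))"
      using l \<epsilon> by (simp add: isometric_embedding_on_def dist_real_def abs_mult flip: right_diff_distrib)
    moreover have "m \<ge> 1" using k by (simp add: m_def)
    ultimately have "power_pair G g h"
      using power_pair_if_common_end[OF boundary, of "\<lambda>t. l (\<epsilon> * t)" g h m 0 "\<epsilon> * \<tau>" 0 0] gh by blast
    then show False using no by simp
  qed
  obtain R1 R2 where R12: "R1 \<ge> 0" "\<And>k::int. k \<noteq> 0 \<Longrightarrow> \<phi> (h [^] k) (l (1 * R1)) \<noteq> l (1 * R1)"
    "R2 \<ge> 0" "\<And>k::int. k \<noteq> 0 \<Longrightarrow> \<phi> (h [^] k) (l ((-1) * R2)) \<noteq> l ((-1) * R2)"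
    using ex[of 1] ex[of "-1"] by auto
  define R where "R = max R1 R2"
  have R: "R \<ge> 0" "R1 \<le> R" "R2 \<le> R" using R12 by (auto simp: R_def)
  \<comment> \<open>A power fixing the point at \<open>R\<close> fixes this half of the axis up to
    there, including the point at \<open>R1\<close> or \<open>R2\<close>.\<close>
  have same: "\<phi> (h [^] k) (l (\<epsilon> * R)) \<noteq> l (\<epsilon> * R)" if "k \<noteq> 0" "\<bar>\<epsilon>\<bar> = 1" for k :: int and \<epsilon>
  proof
    assume *: "\<phi> (h [^] k) (l (\<epsilon> * R)) = l (\<epsilon> * R)"
    have "\<phi> (h [^] k) (l (\<epsilon> * t)) = l (\<epsilon> * t)" if "0 \<le> t" "t \<le> R" for t
      by (rule isometry_between_rays[OF h_iso hp l D \<open>\<bar>\<epsilon>\<bar> = 1\<close> \<open>\<bar>\<epsilon>\<bar> = 1\<close> * that])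
    moreover have "\<epsilon> = 1 \<or> \<epsilon> = - 1" using that by linarith
    ultimately show False using R R12 that(1) by metis
  qed
  text \<open>At most one power of \<open>h\<close> maps \<open>l R\<close> to \<open>l (- R)\<close>, so a multiple of a larger exponent
    never does.\<close>
  obtain N :: nat where N: "N \<ge> 1" "\<And>k::int. k \<noteq> 0 \<Longrightarrow> \<phi> (h [^] (int N * k)) (l R) \<noteq> l (- R)"
  proof (cases "\<exists>j::int. \<phi> (h [^] j) (l R) = l (- R)")
    case True
    then obtain j :: int where j: "\<phi> (h [^] j) (l R) = l (- R)" by blast
    define N where "N = nat \<bar>j\<bar> + 1"
    have "\<phi> (h [^] (int N * k)) (l R) \<noteq> l (- R)" if "k \<noteq> 0" for k
    proof
      assume *: "\<phi> (h [^] (int N * k)) (l R) = l (- R)"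
      have "\<phi> (h [^] (- j) \<otimes> h [^] (int N * k)) (l R) = \<phi> (h [^] (- j) \<otimes> h [^] j) (l R)"
        using gh * j by (simp add: act_mult)
      then have "\<phi> (h [^] (int N * k - j)) (l R) = l R"
        using gh by (simp flip: int_pow_mult)
      then have "int N * k = j"
        using same[of "int N * k - j" 1] by auto
      then have "\<bar>j\<bar> = int N * \<bar>k\<bar>"
        by (metis abs_mult abs_of_nat)
      moreover have "int N * 1 \<le> int N * \<bar>k\<bar>"
        using that by (intro mult_left_mono) auto
      ultimately show False by (simp add: N_def)
    qed
    then show thesis using that[of N] by (simp add: N_def)
  next
    case False
    then show thesis using that[of 1] by simp
  qed
  have moved: "\<phi> (h [^] (int N * k)) (l (\<epsilon> * R)) \<noteq> l (\<delta> * R)"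
    if k: "k \<noteq> 0" and sign: "\<bar>\<epsilon>\<bar> = 1" "\<bar>\<delta>\<bar> = 1" for k and \<epsilon> \<delta> :: real
  proof
    assume *: "\<phi> (h [^] (int N * k)) (l (\<epsilon> * R)) = l (\<delta> * R)"
    have "int N * k \<noteq> 0" using k N by simp
    then have "\<epsilon> \<noteq> \<delta>" using same[of "int N * k" \<epsilon>] sign * by auto
    then consider "\<epsilon> = 1" "\<delta> = - 1" | "\<epsilon> = - 1" "\<delta> = 1" using sign by linarith
    then show False
    proof cases
      case 1
      then show ?thesis using N(2)[OF k] * by simp
    next
      case 2
      then have "\<phi> (inv (h [^] (int N * k))) (l R) = l (- R)"
        using * act_inv(1)[of "h [^] (int N * k)" "l (- R)"] gh by simp
      then show ?thesis using N(2)[of "- k"] k gh by (simp add: int_pow_neg)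
    qed
  qed
  obtain n :: nat where n: "real n * \<tau> > 2 * R"
    using reals_Archimedean3[OF \<tau>] by metis
  then have "n \<ge> 1" using R by (cases n) auto
  \<comment> \<open>One exponent for both: a multiple of \<open>N\<close> for \<open>h\<close>, and
    at least \<open>n\<close> for \<open>g\<close>.\<close>
  define M where "M = N * n"
  have "real n * \<tau> * 1 \<le> real n * \<tau> * real N"
    using N \<tau> by (intro mult_left_mono) simp_all
  then have M: "real M * \<tau> > 2 * R" "M \<ge> 1"
    using n N \<open>n \<ge> 1\<close> by (simp_all add: M_def mult_ac)
  \<comment> \<open>The set is pushed off itself by \<open>g\<close>, and its complement is moved
    into it by \<open>h\<close>; hence the reversed order.\<close>
  have "power_pair G h g"
  proof (rule power_pair_if_ping_pong[OF gh(2,1) M(2), of "{z. \<bar>line_projection l z\<bar> \<le> R}"])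
    fix k :: int and z assume k: "k \<noteq> 0" and z: "z \<notin> {z. \<bar>line_projection l z\<bar> \<le> R}"
    let ?f = "\<phi> (h [^] (int M * k))"
    show "?f z \<in> {z. \<bar>line_projection l z\<bar> \<le> R}"
    proof (rule ccontr)
      assume fz: "?f z \<notin> {z. \<bar>line_projection l z\<bar> \<le> R}"
      \<comment> \<open>The geodesics from \<open>p\<close> to \<open>z\<close> and to
        \<open>?f z\<close> contain the axis points \<open>l (\<epsilon> * R)\<close> and
        \<open>l (\<delta> * R)\<close>, both at distance \<open>D + R\<close> from
        \<open>p\<close>. As \<open>?f\<close> fixes \<open>p\<close>, it maps one to the
        other.\<close>
      obtain \<epsilon> where \<epsilon>: "\<bar>\<epsilon>\<bar> = 1" "dist p (l (\<epsilon> * R)) = D + R" "dist (l (\<epsilon> * R)) z = dist p z - (D + R)"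
        using geodesic_meets_ray[OF l D, of R R z] z R by auto
      obtain \<delta> where \<delta>: "\<bar>\<delta>\<bar> = 1" "dist p (l (\<delta> * R)) = D + R" "dist (l (\<delta> * R)) (?f z) = dist p (?f z) - (D + R)"
        using geodesic_meets_ray[OF l D, of R R "?f z"] fz R by auto
      have "dist p (?f (l (\<epsilon> * R))) = D + R" "dist (?f (l (\<epsilon> * R))) (?f z) = dist p (?f z) - (D + R)"
        using \<epsilon> h_iso[of "int M * k" p] hp[of "int M * k"] h_iso[of "int M * k" "l (\<epsilon> * R)" z] by simp_all
      then have "?f (l (\<epsilon> * R)) = l (\<delta> * R)"
        using dist_points_between[of p "?f (l (\<epsilon> * R))" "?f z" "l (\<delta> * R)"] \<delta> by simp
      moreover have "int M * k = int N * (int n * k)" "int n * k \<noteq> 0"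
        using k \<open>n \<ge> 1\<close> by (simp_all add: M_def)
      ultimately show False using moved[of "int n * k" \<epsilon> \<delta>] \<epsilon>(1) \<delta>(1) by simp
    qed
  next
    fix k :: int and z assume "k \<noteq> 0" "z \<in> {z. \<bar>line_projection l z\<bar> \<le> R}"
    then show "\<phi> (g [^] (int M * k)) z \<notin> {z. \<bar>line_projection l z\<bar> \<le> R}"
      using axis_leaves_interval[OF gh(1) ax M(1)] by (simp add: not_le)
  qed
  then show False using no power_pair_sym[of G h g] by simp
qed

section \<open>Two elements with axes\<close>

lemma power_pair_hyperbolic_hyperbolic:
  assumes boundary: "\<And>\<xi>. \<xi> \<in> gromov_boundary \<Longrightarrow>
      power_alternative (G\<lparr>carrier := stabilizer G (boundary_action \<phi>) \<xi>\<rparr>)"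
    and gh: "g \<in> carrier G" "h \<in> carrier G" and ax: "axis g l \<tau>" and "axis h m' \<sigma>"
  shows "power_pair G g h"
proof (rule ccontr)
  assume no: "\<not> power_pair G g h"
  have l: "isometric_embedding_on UNIV l" and \<tau>: "\<tau> > 0" and gl: "\<And>t. \<phi> g (l t) = l (t + \<tau>)"
    using ax by (auto simp: axis_def)
  \<comment> \<open>The axis of \<open>h\<close> is based at its point nearest to
    \<open>l 0\<close>, so that points at distance \<open>R\<close> from \<open>l 0\<close> have
    coordinates \<open>R\<close> on \<open>l\<close> and \<open>R - D\<close> on \<open>m\<close>,
    up to sign.\<close>
  obtain m D where ax': "axis h m \<sigma>" and D: "\<And>t. dist (l 0) (m t) = D + \<bar>t\<bar>" and "D \<ge> 0"
    using axis_based_at[OF \<open>axis h m' \<sigma>\<close>] by metis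
  have m: "isometric_embedding_on UNIV m" and \<sigma>: "\<sigma> > 0" and hm: "\<And>t. \<phi> h (m t) = m (t + \<sigma>)"
    using ax' by (auto simp: axis_def)
  have l0: "dist (l 0) (l t) = 0 + \<bar>t\<bar>" for t
    using l by (simp add: isometric_embedding_on_def dist_real_def)
  have sign_dist: "dist (c (\<epsilon> * s)) (c (\<epsilon> * t)) = \<bar>s - t\<bar>" if "isometric_embedding_on UNIV c" "\<bar>\<epsilon>\<bar> = 1" for c :: "real \<Rightarrow> 'a" and \<epsilon> s t
    using that by (simp add: isometric_embedding_on_def dist_real_def abs_mult flip: right_diff_distrib)
  \<comment> \<open>Otherwise the two axes share a ray, whose end is fixed by \<open>g\<close> and
    \<open>h\<close>.\<close>
  have ex: "\<exists>R\<ge>D. l (\<epsilon> * R) \<noteq> m (\<delta> * (R - D))" if sign: "\<bar>\<epsilon>\<bar> = 1" "\<bar>\<delta>\<bar> = 1" for \<epsilon> \<delta>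
  proof (rule ccontr)
    assume "\<not> ?thesis"
    then have eq: "\<And>t. t \<ge> D \<Longrightarrow> l (\<epsilon> * t) = m (\<delta> * (t - D))" by blast
    have sq: "\<epsilon> * \<epsilon> = 1" "\<delta> * \<delta> = 1" using sign by (auto simp: abs_if split: if_splits)
    then have "\<phi> g (l (\<epsilon> * t)) = l (\<epsilon> * (t + \<epsilon> * \<tau>))" for t
      by (simp add: gl distrib_left flip: mult.assoc)
    \<comment> \<open>The range starts at \<open>D + \<sigma>\<close>, so that
      \<open>t + \<delta> * \<sigma>\<close> is at least \<open>D\<close> even when
      \<open>\<delta> = - 1\<close>.\<close>
    moreover have "\<phi> (h [^] (1::nat)) (l (\<epsilon> * t)) = l (\<epsilon> * (t + \<delta> * \<sigma>))" if "t \<ge> D + \<sigma>" for t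
    proof -
      have "\<delta> = 1 \<or> \<delta> = - 1" using sign by linarith
      then have "t + \<delta> * \<sigma> \<ge> D" "t \<ge> D" using that \<sigma> by auto
      moreover have "\<delta> * (t - D) + \<sigma> = \<delta> * (t + \<delta> * \<sigma> - D)"
        using sq by (simp add: algebra_simps flip: mult.assoc)
      ultimately show ?thesis using eq[of t] eq[of "t + \<delta> * \<sigma>"] hm[of "\<delta> * (t - D)"] gh by simp
    qed
    moreover have "isometric_embedding_on {0..} (\<lambda>t. l (\<epsilon> * t))"
      using sign_dist[OF l sign(1)] by (simp add: isometric_embedding_on_def dist_real_def)
    ultimately have "power_pair G g h"
      using power_pair_if_common_end[OF boundary, of "\<lambda>t. l (\<epsilon> * t)" g h 1 0 "\<epsilon> * \<tau>" "D + \<sigma>" "\<delta> * \<sigma>"] gh by blast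
    then show False using no by simp
  qed
  \<comment> \<open>Agreement at \<open>R\<close> propagates back along the geodesic from
    \<open>l 0\<close>. Hence a disagreement persists further out, and the maximum of four
    thresholds serves all signs.\<close>
  have down: "l (\<epsilon> * t) = m (\<delta> * (t - D))"
    if sign: "\<bar>\<epsilon>\<bar> = 1" "\<bar>\<delta>\<bar> = 1" and R: "l (\<epsilon> * R) = m (\<delta> * (R - D))" and t: "D \<le> t" "t \<le> R" for \<epsilon> \<delta> t R
  proof -
    have "dist (l 0) (l (\<epsilon> * t)) = t" "dist (l (\<epsilon> * t)) (l (\<epsilon> * R)) = R - t" "dist (l 0) (l (\<epsilon> * R)) = R"
      using l0 sign_dist[OF l sign(1), of t R] t \<open>D \<ge> 0\<close> sign(1) by (simp_all add: abs_mult)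
    moreover have "dist (l 0) (m (\<delta> * (t - D))) = t" "dist (m (\<delta> * (t - D))) (l (\<epsilon> * R)) = R - t"
      using D sign_dist[OF m sign(2), of "t - D" "R - D"] R t sign(2) by (simp_all add: abs_mult)
    ultimately show ?thesis
      using dist_points_between[of "l 0" "l (\<epsilon> * t)" "l (\<epsilon> * R)" "m (\<delta> * (t - D))"] by simp
  qed
  obtain r where r: "\<And>\<epsilon> \<delta>. \<bar>\<epsilon>\<bar> = 1 \<Longrightarrow> \<bar>\<delta>\<bar> = 1 \<Longrightarrow> r \<epsilon> \<delta> \<ge> D \<and> l (\<epsilon> * r \<epsilon> \<delta>) \<noteq> m (\<delta> * (r \<epsilon> \<delta> - D))"
    using ex by metis
  define R where "R = Max {r 1 1, r 1 (-1), r (-1) 1, r (-1) (-1)}"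
  have Rge: "r \<epsilon> \<delta> \<le> R" if "\<bar>\<epsilon>\<bar> = 1" "\<bar>\<delta>\<bar> = 1" for \<epsilon> \<delta>
  proof -
    have "\<epsilon> = 1 \<or> \<epsilon> = - 1" "\<delta> = 1 \<or> \<delta> = - 1" using that by linarith+
    then show ?thesis unfolding R_def by (intro Max_ge) auto
  qed
  have RD: "R \<ge> D" using Rge[of 1 1] r[of 1 1] by simp
  have branch: "l (\<epsilon> * R) \<noteq> m (\<delta> * (R - D))" if "\<bar>\<epsilon>\<bar> = 1" "\<bar>\<delta>\<bar> = 1" for \<epsilon> \<delta>
    using down[OF that, of R "r \<epsilon> \<delta>"] r[OF that] Rge[OF that] by blast
  \<comment> \<open>If both projections were beyond \<open>R\<close>, the geodesic from
    \<open>l 0\<close> to \<open>z\<close> would contain \<open>l (\<epsilon> * R)\<close> and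
    \<open>m (\<delta> * (R - D))\<close>; both are at distance \<open>R\<close> from
    \<open>l 0\<close>, so they would coincide.\<close>
  have proj: "\<bar>line_projection m z\<bar> \<le> R" if z: "\<bar>line_projection l z\<bar> > R" for z
  proof (rule ccontr)
    assume z': "\<not> ?thesis"
    obtain \<epsilon> where \<epsilon>: "\<bar>\<epsilon>\<bar> = 1" "dist (l 0) (l (\<epsilon> * R)) = 0 + R" "dist (l (\<epsilon> * R)) z = dist (l 0) z - (0 + R)"
      using geodesic_meets_ray[OF l l0, of R R z] z RD \<open>D \<ge> 0\<close> by auto
    obtain \<delta> where \<delta>: "\<bar>\<delta>\<bar> = 1" "dist (l 0) (m (\<delta> * (R - D))) = D + (R - D)"
      "dist (m (\<delta> * (R - D))) z = dist (l 0) z - (D + (R - D))"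
      using geodesic_meets_ray[OF m D, of "R - D" R z] z' RD \<open>D \<ge> 0\<close> by auto
    have "l (\<epsilon> * R) = m (\<delta> * (R - D))"
      using dist_points_between[of "l 0" "l (\<epsilon> * R)" z "m (\<delta> * (R - D))"] \<epsilon> \<delta> by simp
    then show False using branch \<epsilon>(1) \<delta>(1) by blast
  qed
  obtain n1 n2 :: nat where n: "real n1 * \<tau> > 2 * R" "real n2 * \<sigma> > 2 * R"
    using reals_Archimedean3[OF \<tau>] reals_Archimedean3[OF \<sigma>] by metis
  define N where "N = max 1 (max n1 n2)"
  have "real n1 * \<tau> \<le> real N * \<tau>" "real n2 * \<sigma> \<le> real N * \<sigma>"
    using \<tau> \<sigma> by (auto intro!: mult_right_mono simp: N_def)
  then have N: "real N * \<tau> > 2 * R" "real N * \<sigma> > 2 * R" "N \<ge> 1"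
    using n by (auto simp: N_def)
  have "power_pair G h g"
  proof (rule power_pair_if_ping_pong[OF gh(2,1) N(3), of "{z. \<bar>line_projection l z\<bar> \<le> R}"])
    fix k :: int and z assume k: "k \<noteq> 0" and z: "z \<notin> {z. \<bar>line_projection l z\<bar> \<le> R}"
    \<comment> \<open>By \<open>proj\<close> the projection of \<open>z\<close> to \<open>m\<close>
      is within \<open>R\<close>, and \<open>h\<close> pushes it beyond; by \<open>proj\<close>
      again, the projection of the image to \<open>l\<close> is within \<open>R\<close>.\<close>
    then have "\<bar>line_projection m (\<phi> (h [^] (int N * k)) z)\<bar> > R"
      using proj[of z] by (intro axis_leaves_interval[OF gh(2) ax' N(2)]) auto
    then show "\<phi> (h [^] (int N * k)) z \<in> {z. \<bar>line_projection l z\<bar> \<le> R}"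
      using proj[of "\<phi> (h [^] (int N * k)) z"] by fastforce
  next
    fix k :: int and z assume "k \<noteq> 0" "z \<in> {z. \<bar>line_projection l z\<bar> \<le> R}"
    then show "\<phi> (g [^] (int N * k)) z \<notin> {z. \<bar>line_projection l z\<bar> \<le> R}"
      using axis_leaves_interval[OF gh(1) ax N(1)] by (simp add: not_le)
  qed
  then show False using no power_pair_sym[of G h g] by simp
qed

end

section \<open>The theorem by cases\<close>

lemma tree_action_if_isometric_action:
  fixes \<phi> :: "'g \<Rightarrow> 'a::real_tree \<Rightarrow> 'a"
  assumes "isometric_action G \<phi>"
  shows "tree_action G \<phi>"
proof -
  interpret group_action G UNIV \<phi>
    using assms by (simp add: isometric_action_def)
  interpret group G
    using group_hom by (rule group_hom.axioms(1))
  show ?thesis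
  proof unfold_locales
    show "\<phi> \<one>\<^bsub>G\<^esub> x = x" for x
      using fun_cong[OF id_eq_one, of x] by simp
    show "\<phi> (g \<otimes>\<^bsub>G\<^esub> h) x = \<phi> g (\<phi> h x)" if "g \<in> carrier G" "h \<in> carrier G" for g h x
      using composition_rule that by simp
    show "dist (\<phi> g x) (\<phi> g y) = dist x y" if "g \<in> carrier G" for g x y
      using assms that unfolding isometric_action_def by blast
  qed
qed

theorem theorem3p1:
  fixes G :: "('g, 'm) monoid_scheme"
    and \<phi> :: "'g \<Rightarrow> 'a::real_tree \<Rightarrow> 'a"
  assumes "isometric_action G \<phi>"
    and "stabilisation_property G \<phi>"
    and "\<And>x. power_alternative (G\<lparr>carrier := stabilizer G \<phi> x\<rparr>)"
    and "\<And>\<xi>. \<xi> \<in> gromov_boundary \<Longrightarrow>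
           power_alternative (G\<lparr>carrier := stabilizer G (boundary_action \<phi>) \<xi>\<rparr>)"
  shows "power_alternative G"
proof -
  interpret tree_action G \<phi>
    using assms(1) by (rule tree_action_if_isometric_action)
  show ?thesis
    unfolding power_alternative_iff
  proof (intro ballI)
    fix g h assume gh: "g \<in> carrier G" "h \<in> carrier G"
    have g: "(\<exists>p. \<phi> g p = p) \<or> (\<exists>l \<tau>. axis g l \<tau>)"
      by (rule elliptic_or_axis[OF gh(1)]) blast+
    have h: "(\<exists>q. \<phi> h q = q) \<or> (\<exists>m \<sigma>. axis h m \<sigma>)"
      by (rule elliptic_or_axis[OF gh(2)]) blast+
    show "power_pair G g h"
    proof (cases "\<exists>p. \<phi> g p = p"; cases "\<exists>q. \<phi> h q = q")
      assume "\<exists>p. \<phi> g p = p" "\<exists>q. \<phi> h q = q"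
      then obtain p q where "\<phi> g p = p" "\<phi> h q = q" by blast
      then show ?thesis by (rule power_pair_elliptic_elliptic[OF gh _ _ assms(3)])
    next
      assume "\<exists>p. \<phi> g p = p" "\<nexists>q. \<phi> h q = q"
      then obtain p m \<sigma> where "axis h m \<sigma>" "\<phi> g p = p" using h by blast
      then have "power_pair G h g" 
        by (intro power_pair_hyperbolic_elliptic[OF assms(2) _ gh(2,1)] assms(4))
      then show ?thesis by (rule power_pair_sym)
    next
      assume "\<nexists>p. \<phi> g p = p" "\<exists>q. \<phi> h q = q"
      then obtain l \<tau> q where "axis g l \<tau>" "\<phi> h q = q" using g by blast
      then show ?thesis 
        by (intro power_pair_hyperbolic_elliptic[OF assms(2) _ gh] assms(4))
    next
      assume "\<nexists>p. \<phi> g p = p" "\<nexists>q. \<phi> h q = q"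
      then obtain l \<tau> m \<sigma> where "axis g l \<tau>" "axis h m \<sigma>" using g h by blast
      then show ?thesis 
        by (intro power_pair_hyperbolic_hyperbolic[OF _ gh] assms(4))
    qed
  qed
qed

end
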